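(* Let $w\in W(\ell_a,\ell_b)$ be a word with signature $(A,B)$. The path of the unique maximal word (with respect to $\preceq$) in the $\sim_2$-class of $w$ is the path $\overline{\gamma}$ constructed from $(A,B)$ as described in the context.
   Context: Let $\mathbb{T}=(\mathbb{R}\cup\{-\infty\},\oplus,\odot)$, $x\oplus y=\max(x,y)$, $x\odot y=x+y$. $\mathcal{UT}_2(\mathbb{T})$ is the semigroup of $2\times2$ matrices $M$ over $\mathbb{T}$ with $M_{21}=-\infty$ under tropical matrix multiplication. For $w,v\in\{a,b\}^+$, $w\sim_2 v$ means $\varphi(w)=\varphi(v)$ for every semigroup morphism $\varphi:\{a,b\}^+\to\mathcal{UT}_2(\mathbb{T})$. $\ell_a,\ell_b\in\mathbb{N}$. $W(\ell_a,\ell_b)$ is the set of words over $\{a,b\}$ with $\ell_a$ occurrences of $a$ and $\ell_b$ of $b$. The path of $w$ is the set of lattice points of the staircase walk from $(0,0)$ to $(\ell_a,\ell_b)$ obtained by reading $w$ from left to right, moving by $(1,0)$ for each $a$ and $(0,1)$ for each $b$. $w\preceq v$ means that the path of $w$ does not rise above that of $v$; $W(\ell_a,\ell_b)$ is a distributive lattice for this order and each $\sim_2$-class has a unique maximal element. For $0\le i\le\ell_a-1$ let $\alpha_i^w$ be the number of $b$'s preceding the $(i+1)$th $a$ of $w$, and for $0\le i\le\ell_b-1$ let $\beta_i^w$ be the number of $a$'s preceding the $(i+1)$th $b$ of $w$. The signature of $w$ is the pair of polygons $A=\mathrm{conv}\{(i,\alpha_i^w)\}$, $B=\mathrm{conv}\{(\beta_i^w,i)\}$.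 Write $p\trianglelefteq q$ for the coordinatewise order on $\mathbb{N}_{\ge0}^2$, $x(p),y(p)$ for the coordinates of $p$, $[p,q]=\{r\in\mathbb{N}_{\ge0}^2:p\trianglelefteq r\trianglelefteq q\}$, and $(p,q)=[p,q]\setminus\{p,q\}$. Construction of $\overline\gamma$. Let $(0,0)=p_1\triangleleft p_2\triangleleft\cdots\triangleleft p_M\triangleleft p_{M+1}=(\ell_a,\ell_b)$ be the increasing sequence formed by all vertices of $A$, all vertices of $B$, and the point $(\ell_a,\ell_b)$. Set $\mathrm{label}(p_i)=a$ if $p_i$ is a vertex of $A$, $b$ if it is a vertex of $B$, and $\emptyset$ if $p_i=(\ell_a,\ell_b)$. For each $i=1,\dots,M$ construct $\overline\gamma(i)$ as follows. Start with $p=p_i$ with its label, and $\overline\gamma(i)=\{p_i\}$. While $p\ne p_{i+1}$, compute a point $p'$ and a label for $p'$ by: - if $y(p)=y(p_{i+1})$ or $x(p)=x(p_{i+1})$: $p'=p_{i+1}$ with $\mathrm{label}(p')=\mathrm{label}(p_{i+1})$; - otherwise, if $\mathrm{label}(p)=b$: let $Y=\{k: y(p)<k\le y(p_{i+1}),\ (x(p),k)\in A,\ (x(p),k-1)\in B\}$, and put $p'=(x(p),\max Y)$ with $\mathrm{label}(p')=a$; - otherwise, if $\mathrm{label}(p)=a$: let $X=\{k: x(p)<k\le x(p_{i+1}),\ (k,y(p))\in B,\ (k-1,y(p))\in A,\ (k,y(p)+r)\in A\text{ for some }r>0\}$, and put $p'=(\min X,y(p))$ with $\mathrm{label}(p')=b$.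 Then add $[p,p']$ to $\overline\gamma(i)$, give all points of $(p,p')$ the label of $p$, and replace $p$ by $p'$ (with its label). Finally $\overline\gamma:=\bigcup_{i=1}^M\overline\gamma(i)$. *)

theory Defs
  imports "HOL-Analysis.Analysis"
begin

section \<open>The tropical semiring and upper triangular tropical matrices\<close>

datatype trop = NegInf | Fin real

text \<open>
  The class operations are the tropical ones: \<open>+\<close> is the maximum, \<open>*\<close> is the addition of reals,
  so \<open>0\<close> denotes minus infinity and \<open>1\<close> denotes the real number zero. Consequently \<open>**\<close> on
  \<^typ>\<open>trop^2^2\<close> is the tropical matrix product.
\<close>

instantiation trop :: comm_semiring_1
begin

definition zero_trop :: trop where "0 = NegInf"

definition one_trop :: trop where "1 = Fin 0"

fun plus_trop :: "trop \<Rightarrow> trop \<Rightarrow> trop" where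
  "plus_trop NegInf y = y"
| "plus_trop (Fin x) NegInf = Fin x"
| "plus_trop (Fin x) (Fin y) = Fin (max x y)"

fun times_trop :: "trop \<Rightarrow> trop \<Rightarrow> trop" where
  "times_trop NegInf y = NegInf"
| "times_trop (Fin x) NegInf = NegInf"
| "times_trop (Fin x) (Fin y) = Fin (x + y)"

instance
proof
  fix x y z :: trop
  show "x + y + z = x + (y + z)" by (cases x; cases y; cases z) auto
  show "x + y = y + x" by (cases x; cases y) auto
  show "0 + x = x" by (simp add: zero_trop_def)
  show "x * y * z = x * (y * z)" by (cases x; cases y; cases z) auto
  show "x * y = y * x" by (cases x; cases y) auto
  show "1 * x = x" by (cases x) (auto simp: one_trop_def)
  show "(x + y) * z = x * z + y * z" by (cases x; cases y; cases z) auto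
  show "0 * x = 0" by (simp add: zero_trop_def)
  show "x * 0 = 0" by (cases x) (auto simp: zero_trop_def)
  show "(0::trop) \<noteq> 1" by (simp add: zero_trop_def one_trop_def)
qed

end

definition UT2 :: "(trop^2^2) set" where
  "UT2 = {M. M $ 2 $ 1 = NegInf}"

section \<open>Words, paths and the equivalence relation\<close>

datatype letter = La | Lb

definition words :: "nat \<Rightarrow> nat \<Rightarrow> letter list set" where
  "words la lb = {w. count_list w La = la \<and> count_list w Lb = lb}"

definition UT2_morphism :: "(letter list \<Rightarrow> trop^2^2) \<Rightarrow> bool" where
  "UT2_morphism \<phi> \<longleftrightarrow>
     (\<forall>u. u \<noteq> [] \<longrightarrow> \<phi> u \<in> UT2) \<and>
     (\<forall>u v. u \<noteq> [] \<longrightarrow> v \<noteq> [] \<longrightarrow> \<phi> (u @ v) = \<phi> u ** \<phi> v)"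

definition sim2 :: "letter list \<Rightarrow> letter list \<Rightarrow> bool" (infix "\<sim>\<^sub>2" 50) where
  "w \<sim>\<^sub>2 v \<longleftrightarrow> (\<forall>\<phi>. UT2_morphism \<phi> \<longrightarrow> \<phi> w = \<phi> v)"

definition word_path :: "letter list \<Rightarrow> (nat \<times> nat) set" where
  "word_path w = {(count_list (take n w) La, count_list (take n w) Lb) | n. n \<le> length w}"

text \<open>
  The path of \<open>w\<close> does not rise above that of \<open>v\<close>: every point of the path of \<open>w\<close> is at most as
  high as some point of the path of \<open>v\<close> on the same vertical line.
\<close>

definition path_le :: "letter list \<Rightarrow> letter list \<Rightarrow> bool" (infix "\<preceq>" 50) where
  "w \<preceq> v \<longleftrightarrow> (\<forall>p \<in> word_path w. \<exists>q \<in> word_path v. fst q = fst p \<and> snd p \<le> snd q)"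

definition sim2_class :: "letter list \<Rightarrow> letter list set" where
  "sim2_class w = {v. v \<noteq> [] \<and> w \<sim>\<^sub>2 v}"

definition maximal_in_class :: "letter list \<Rightarrow> letter list \<Rightarrow> bool" where
  "maximal_in_class w v \<longleftrightarrow>
     v \<in> sim2_class w \<and> (\<forall>u \<in> sim2_class w. v \<preceq> u \<longrightarrow> u = v)"

section \<open>The signature\<close>

text \<open>The index in \<open>w\<close> of the (i+1)th occurrence of the letter \<open>c\<close>.\<close>

definition occ :: "letter \<Rightarrow> letter list \<Rightarrow> nat \<Rightarrow> nat" where
  "occ c w i = filter (\<lambda>n. w ! n = c) [0..<length w] ! i"

definition alpha :: "letter list \<Rightarrow> nat \<Rightarrow> nat" where
  "alpha w i = count_list (take (occ La w i) w) Lb"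

definition beta :: "letter list \<Rightarrow> nat \<Rightarrow> nat" where
  "beta w i = count_list (take (occ Lb w i) w) La"

definition signature :: "letter list \<Rightarrow> (real \<times> real) set \<times> (real \<times> real) set" where
  "signature w =
     (convex hull {(real i, real (alpha w i)) | i. i < count_list w La},
      convex hull {(real (beta w i), real i) | i. i < count_list w Lb})"

section \<open>The construction from a pair of polygons\<close>

text \<open>
  The order on \<^typ>\<open>nat \<times> nat\<close> is the coordinatewise one of \<^theory>\<open>HOL-Library.Product_Order\<close>;
  in particular \<open>{p..q}\<close> is the set of lattice points of a box.
\<close>

definition real_point :: "nat \<times> nat \<Rightarrow> real \<times> real" where
  "real_point p = (real (fst p), real (snd p))"

text \<open>The vertices of the signature polygons are lattice points, so none is lost here.\<close>

definition vertices :: "(real \<times> real) set \<Rightarrow> (nat \<times> nat) set" where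
  "vertices P = {p. real_point p extreme_point_of P}"

definition marked_points ::
    "nat \<Rightarrow> nat \<Rightarrow> (real \<times> real) set \<Rightarrow> (real \<times> real) set \<Rightarrow> (nat \<times> nat) list" where
  "marked_points la lb A B =
     (THE ps. sorted_wrt (<) ps \<and> set ps = vertices A \<union> vertices B \<union> {(la, lb)})"

text \<open>\<open>None\<close> is the empty label. For a signature, \<open>vertices A\<close>, \<open>vertices B\<close> and \<open>{(la, lb)}\<close>
  are pairwise disjoint.\<close>

definition label :: "(real \<times> real) set \<Rightarrow> (real \<times> real) set \<Rightarrow> nat \<times> nat \<Rightarrow> letter option" where
  "label A B p =
     (if p \<in> vertices A then Some La else if p \<in> vertices B then Some Lb else None)"

text \<open>
  One pass through the loop that heads for the marked point \<open>q\<close>: from \<open>p\<close> with label \<open>l\<close> to the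
  next point with its label. The value is \<open>None\<close> if the prescribed maximum or minimum
  does not exist.
\<close>

definition gamma_step ::
    "(real \<times> real) set \<Rightarrow> (real \<times> real) set \<Rightarrow> nat \<times> nat \<Rightarrow> nat \<times> nat \<Rightarrow> letter option
      \<Rightarrow> ((nat \<times> nat) \<times> letter option) option" where
  "gamma_step A B q p l =
     (if snd p = snd q \<or> fst p = fst q then Some (q, label A B q)
      else case l of
        Some Lb \<Rightarrow>
          (let Y = {k. snd p < k \<and> k \<le> snd q \<and>
                       real_point (fst p, k) \<in> A \<and> real_point (fst p, k - 1) \<in> B}
           in if Y = {} then None else Some ((fst p, Max Y), Some La))
      | Some La \<Rightarrow>
          (let X = {k. fst p < k \<and> k \<le> fst q \<and>
                       real_point (k, snd p) \<in> B \<and> real_point (k - 1, snd p) \<in> A \<and>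
                       (\<exists>r::nat. r > 0 \<and> real_point (k, snd p + r) \<in> A)}
           in if X = {} then None else Some ((Min X, snd p), Some Lb))
      | None \<Rightarrow> None)"

text \<open>
  The loop, with accumulator \<open>S\<close>; the value is \<open>None\<close> if some pass is impossible or
  if \<open>q\<close> is never reached. The labels of the points strictly between \<open>p\<close> and \<open>p'\<close> influence
  neither the control flow nor the resulting set of points and are not recorded.
\<close>

partial_function (option) gamma_loop ::
    "(real \<times> real) set \<Rightarrow> (real \<times> real) set \<Rightarrow> nat \<times> nat \<Rightarrow> nat \<times> nat \<Rightarrow> letter option
      \<Rightarrow> (nat \<times> nat) set \<Rightarrow> (nat \<times> nat) set option" where
  "gamma_loop A B q p l S =
     (if p = q then Some S
      else Option.bind (gamma_step A B q p l)
             (\<lambda>(p', l'). gamma_loop A B q p' l' (S \<union> {p..p'})))"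

definition gamma_segment ::
    "(real \<times> real) set \<Rightarrow> (real \<times> real) set \<Rightarrow> nat \<times> nat \<Rightarrow> nat \<times> nat
      \<Rightarrow> (nat \<times> nat) set option" where
  "gamma_segment A B p q = gamma_loop A B q p (label A B p) {p}"

text \<open>The value is \<open>Some S\<close> iff all the loops succeed, and then \<open>S\<close> is the union of their results.\<close>

definition gamma_bar ::
    "nat \<Rightarrow> nat \<Rightarrow> (real \<times> real) set \<Rightarrow> (real \<times> real) set \<Rightarrow> (nat \<times> nat) set option" where
  "gamma_bar la lb A B =
     (let ps = marked_points la lb A B
      in map_option (\<lambda>Ss. \<Union> (set Ss))
           (those (map (\<lambda>i. gamma_segment A B (ps ! i) (ps ! Suc i)) [0..<length ps - 1])))"

end

theory Submission
  imports Defs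
begin

text \<open>
  The corner entry of the image of a word under a morphism into \<open>UT2\<close> is a tropical sum with one
  term for each position of the word. Suppose first that the diagonal entries are real numbers.
  For a position carrying the letter \<open>c\<close> the term is an affine function, depending only on \<open>c\<close>
  and on the two letter counts of the word, evaluated at the point where that step starts. So the entry is the larger of two support functions up
  to constants, one for the starting points of the steps \<open>a\<close> and one for those of the steps
  \<open>b\<close>; a corner entry minus infinity for one letter isolates the other. A diagonal entry minus
  infinity restricts the sum to a face of the polygon. Hence two nonempty words are equivalent iff
  their paths end at the same point and their signatures agree (\<open>sim2_iff_signature\<close>). In other words, the class of \<open>w\<close> consists of the
  paths to \<open>(la, lb)\<close> whose steps \<open>a\<close> start in \<open>A\<close> and whose steps \<open>b\<close> start in \<open>B\<close>,
  and which leave every vertex of \<open>A\<close> with an \<open>a\<close> and every vertex of \<open>B\<close> with a \<open>b\<close>.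

  Maximal words exist because the class is finite and \<open>\<preceq>\<close> is a partial order. The heart of the
  proof is that a maximal word \<open>v\<close> admits no local raise (\<open>no_local_raise\<close>): if \<open>v\<close> runs to
  the right from \<open>(x, y)\<close> and then goes up, no vertex lies on that stretch, \<open>(x, y)\<close> is in
  \<open>B\<close> and \<open>(x, y + 1)\<close> is in \<open>A\<close>, then the up step can be moved to the front of the stretch.
  The raised word keeps all vertices, and by convexity of \<open>A\<close> its new steps still start in the
  right polygons, so it is a higher word of the class.

  This determines every turn of \<open>v\<close> between two consecutive marked points. When \<open>v\<close> goes up,
  it turns right at the highest admissible point, since if there were an admissible point above the
  turn, convexity would make the next right run of \<open>v\<close> raisable. When \<open>v\<close> goes right, it turns
  up at the first admissible point, since at an earlier one the rest of the run would be raisable.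
  These are the maximum and the minimum that the construction takes, so the construction succeeds
  and returns the path of \<open>v\<close>. As this holds for every maximal \<open>v\<close>, while the construction
  depends only on the end point and \<open>(A, B)\<close> and a path determines its word, there is only one maximal word.
\<close>

section \<open>Lattice paths of words\<close>

definition pt :: "letter list \<Rightarrow> nat \<Rightarrow> nat \<times> nat" where
  "pt w n = (count_list (take n w) La, count_list (take n w) Lb)"

text \<open>
  The polygons of the signature are the convex hulls of these sets of starting points of steps.
\<close>

definition starts :: "letter \<Rightarrow> letter list \<Rightarrow> (nat \<times> nat) set" where
  "starts c w = {pt w n | n. n < length w \<and> w ! n = c}"

abbreviation hull_of :: "letter \<Rightarrow> letter list \<Rightarrow> (real \<times> real) set" where
  "hull_of c w \<equiv> convex hull (real_point ` starts c w)"

lemma pt_0 [simp]: "pt w 0 = (0, 0)"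
  by (simp add: pt_def)

lemma pt_Suc:
  assumes "n < length w"
  shows "pt w (Suc n) = (if w ! n = La then (Suc (fst (pt w n)), snd (pt w n))
                         else (fst (pt w n), Suc (snd (pt w n))))"
  using assms by (cases "w ! n") (auto simp: pt_def take_Suc_conv_app_nth)

lemma pt_sum: "n \<le> length w \<Longrightarrow> fst (pt w n) + snd (pt w n) = n"
  by (induction n) (auto simp: pt_Suc)

lemma pt_mono:
  assumes "n \<le> m" shows "pt w n \<le> pt w m"
proof -
  have "take m w = take n w @ take (m - n) (drop n w)"
    using assms by (metis le_add_diff_inverse take_add)
  then show ?thesis by (simp add: pt_def less_eq_prod_def)
qed

lemma pt_fst_mono: "n \<le> m \<Longrightarrow> fst (pt w n) \<le> fst (pt w m)"
  and pt_snd_mono: "n \<le> m \<Longrightarrow> snd (pt w n) \<le> snd (pt w m)"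
  using pt_mono[of n m w] by (auto simp: less_eq_prod_def)

lemma pt_inj: "n \<le> length w \<Longrightarrow> m \<le> length w \<Longrightarrow> pt w n = pt w m \<Longrightarrow> n = m"
  by (metis pt_sum)

lemma pt_less_iff:
  assumes "n \<le> length w" "m \<le> length w"
  shows "pt w n < pt w m \<longleftrightarrow> n < m"
proof
  assume "pt w n < pt w m"
  then show "n < m" by (meson leD not_le_imp_less pt_mono)
next
  assume "n < m"
  then show "pt w n < pt w m"
    using pt_mono[of n m w] pt_inj[OF assms] by (auto simp: order.strict_iff_order)
qed

lemma pt_length: "pt w (length w) = (count_list w La, count_list w Lb)"
  by (simp add: pt_def)

lemma pt_le_counts: "fst (pt w n) \<le> count_list w La" "snd (pt w n) \<le> count_list w Lb"
proof -
  have "count_list w c = count_list (take n w) c + count_list (drop n w) c" for c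
    by (metis append_take_drop_id count_list_append)
  then show "fst (pt w n) \<le> count_list w La" "snd (pt w n) \<le> count_list w Lb"
    by (simp_all add: pt_def)
qed

lemma pt_append1: "n \<le> length u \<Longrightarrow> pt (u @ v) n = pt u n"
  by (simp add: pt_def)

lemma pt_append2: "pt (u @ v) (length u + n) = pt u (length u) + pt v n"
  by (simp add: pt_def)

lemma word_path_eq: "word_path w = pt w ` {..length w}"
  by (auto simp: word_path_def pt_def)

lemma word_path_append:
  "word_path (u @ v) = word_path u \<union> (+) (pt u (length u)) ` word_path v"
proof -
  have "{..length (u @ v)} = {..length u} \<union> (+) (length u) ` {..length v}"
  proof -
    have "{..length u + length v} = {..length u} \<union> {length u..length u + length v}" by auto
    then show ?thesis
      using image_add_atLeastAtMost[of "length u" 0 "length v"] by (simp add: atLeast0AtMost add.commute)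
  qed
  then show ?thesis
    by (simp only: word_path_eq image_Un image_image pt_append2)
       (simp add: pt_append1)
qed

lemma starts_append:
  "starts c (u @ v) = starts c u \<union> (+) (pt u (length u)) ` starts c v"
proof (intro equalityI subsetI)
  fix p assume "p \<in> starts c (u @ v)"
  then obtain n where n: "n < length u + length v" "(u @ v) ! n = c" "p = pt (u @ v) n"
    by (auto simp: starts_def)
  show "p \<in> starts c u \<union> (+) (pt u (length u)) ` starts c v"
  proof (cases "n < length u")
    case True
    then show ?thesis using n by (auto simp: starts_def pt_append1 nth_append)
  next
    case False
    then obtain k where "n = length u + k" by (metis le_add_diff_inverse not_less)
    then show ?thesis using n by (auto simp: starts_def pt_append2)
  qed
next
  fix p assume "p \<in> starts c u \<union> (+) (pt u (length u)) ` starts c v"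
  then show "p \<in> starts c (u @ v)"
  proof
    assume "p \<in> starts c u"
    then obtain n where "n < length u" "u ! n = c" "p = pt u n" by (auto simp: starts_def)
    then show ?thesis
      by (auto simp: starts_def nth_append pt_append1 intro!: exI[of _ n])
  next
    assume "p \<in> (+) (pt u (length u)) ` starts c v"
    then obtain n where "n < length v" "v ! n = c" "p = pt u (length u) + pt v n"
      by (auto simp: starts_def)
    then show ?thesis
      by (auto simp: starts_def pt_append2 intro!: exI[of _ "length u + n"])
  qed
qed

lemma starts_Nil [simp]: "starts c [] = {}"
  by (simp add: starts_def)

lemma starts_single: "starts c [d] = (if c = d then {(0, 0)} else {})"
  by (auto simp: starts_def)

lemma finite_starts [simp]: "finite (starts c w)"
  by (simp add: starts_def)

lemma pt_in_starts: "n < length w \<Longrightarrow> pt w n \<in> starts (w ! n) w"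
  by (auto simp: starts_def)

lemma pt_in_starts_iff: "n < length w \<Longrightarrow> pt w n \<in> starts c w \<longleftrightarrow> w ! n = c"
  by (auto simp: starts_def dest: pt_inj[OF less_imp_le less_imp_le])

lemma positions_snoc:
  "filter (\<lambda>n. (w @ [d]) ! n = c) [0..<length (w @ [d])] =
   filter (\<lambda>n. w ! n = c) [0..<length w] @ (if d = c then [length w] else [])"
proof -
  have "filter (\<lambda>n. (w @ [d]) ! n = c) [0..<length w] = filter (\<lambda>n. w ! n = c) [0..<length w]"
    by (rule filter_cong) (auto simp: nth_append)
  then show ?thesis by simp
qed

lemma length_positions: "length (filter (\<lambda>n. w ! n = c) [0..<length w]) = count_list w c"
proof (induction w rule: rev_induct)
  case (snoc d w)
  then show ?case unfolding positions_snoc by simp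
qed simp

lemma occ_snoc:
  "i < count_list w c \<Longrightarrow> occ c (w @ [d]) i = occ c w i"
  "occ c (w @ [c]) (count_list w c) = length w"
  unfolding occ_def positions_snoc by (simp_all add: nth_append length_positions)

lemma occ_less: "i < count_list w c \<Longrightarrow> occ c w i < length w"
  using nth_mem[of i "filter (\<lambda>n. w ! n = c) [0..<length w]"]
  by (auto simp: occ_def length_positions)

lemma starts_snoc:
  "starts c (w @ [d]) = starts c w \<union> (if c = d then {(count_list w La, count_list w Lb)} else {})"
  by (auto simp: starts_append starts_single pt_length)

text \<open>
  The induction appends letters on the right because the indices of \<open>alpha\<close> count occurrences from
  the left, so that the earlier values do not change.
\<close>

lemma starts_La_eq: "starts La w = {(i, alpha w i) | i. i < count_list w La}"
proof (induction w rule: rev_induct)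
  case (snoc d w)
  have "{(i, alpha (w @ [d]) i) | i. i < count_list w La} = {(i, alpha w i) | i. i < count_list w La}"
    using occ_less[of _ w La] by (fastforce simp: alpha_def occ_snoc(1) less_imp_le)
  moreover have "d = La \<Longrightarrow> alpha (w @ [d]) (count_list w La) = count_list w Lb"
    by (simp add: alpha_def occ_snoc(2))
  ultimately show ?case
    by (auto simp: starts_snoc snoc less_Suc_eq)
qed simp

lemma starts_Lb_eq: "starts Lb w = {(beta w i, i) | i. i < count_list w Lb}"
proof (induction w rule: rev_induct)
  case (snoc d w)
  have "{(beta (w @ [d]) i, i) | i. i < count_list w Lb} = {(beta w i, i) | i. i < count_list w Lb}"
    using occ_less[of _ w Lb] by (fastforce simp: beta_def occ_snoc(1) less_imp_le)
  moreover have "d = Lb \<Longrightarrow> beta (w @ [d]) (count_list w Lb) = count_list w La"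
    by (simp add: beta_def occ_snoc(2))
  ultimately show ?case
    by (auto simp: starts_snoc snoc less_Suc_eq)
qed simp

lemma signature_eq: "signature w = (hull_of La w, hull_of Lb w)"
proof -
  have "{(real i, real (alpha w i)) | i. i < count_list w La} = real_point ` starts La w"
    by (auto simp: starts_La_eq real_point_def image_iff)
  moreover have "{(real (beta w i), real i) | i. i < count_list w Lb} = real_point ` starts Lb w"
    by (auto simp: starts_Lb_eq real_point_def image_iff)
  ultimately show ?thesis by (simp add: signature_def)
qed

section \<open>Convexity in the plane\<close>

text \<open>
  A point at which a linear functional has a strict minimum is outside the hull of the others,
  hence is a vertex.
\<close>

lemma strict_minimum_extreme:
  fixes x :: "real \<times> real"
  assumes "finite S" "x \<in> S" and min: "\<And>y. y \<in> S \<Longrightarrow> y \<noteq> x \<Longrightarrow> inner d x < inner d y"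
  shows "x extreme_point_of convex hull S"
proof -
  have "convex hull (insert x (S - {x})) = convex hull S" using assms by (simp add: insert_absorb)
  moreover have "x \<notin> convex hull (S - {x})"
  proof
    assume "x \<in> convex hull (S - {x})"
    moreover have "convex hull (S - {x}) \<subseteq> {y. inner d y > inner d x}"
      using min by (intro hull_minimal) (auto simp: convex_halfspace_gt)
    ultimately show False by auto
  qed
  ultimately show ?thesis
    using extreme_point_of_convex_hull_insert[of "S - {x}" x] assms(1) by simp
qed

lemma between_as_convex_combination:
  fixes x :: real
  assumes "x1 \<le> x" "x \<le> x2"
  obtains t where "0 \<le> t" "t \<le> 1" "x = (1 - t) * x1 + t * x2"
proof -
  have "x \<in> closed_segment x1 x2" using assms by (simp add: closed_segment_eq_real_ivl)
  then show ?thesis using that by (auto simp: in_segment)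
qed

lemma convex_pair_combination:
  fixes A :: "(real \<times> real) set"
  assumes "convex A" "(x1, y1) \<in> A" "(x2, y2) \<in> A" "0 \<le> t" "t \<le> 1"
  shows "((1 - t) * x1 + t * x2, (1 - t) * y1 + t * y2) \<in> A"
  using convexD_alt[OF assms] by simp

lemma convex_vertical:
  fixes A :: "(real \<times> real) set"
  assumes "convex A" "(x, y1) \<in> A" "(x, y2) \<in> A" "y1 \<le> y" "y \<le> y2"
  shows "(x, y) \<in> A"
proof -
  obtain t where "0 \<le> t" "t \<le> 1" "y = (1 - t) * y1 + t * y2"
    using between_as_convex_combination assms(4,5) .
  moreover have "(1 - t) * x + t * x = x" by (simp add: algebra_simps)
  ultimately show ?thesis
    using convex_pair_combination[OF assms(1-3), of t] by simp
qed

lemma convex_horizontal: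
  fixes A :: "(real \<times> real) set"
  assumes "convex A" "(x1, y) \<in> A" "(x2, y) \<in> A" "x1 \<le> x" "x \<le> x2"
  shows "(x, y) \<in> A"
proof -
  obtain t where "0 \<le> t" "t \<le> 1" "x = (1 - t) * x1 + t * x2"
    using between_as_convex_combination assms(4,5) .
  moreover have "(1 - t) * y + t * y = y" by (simp add: algebra_simps)
  ultimately show ?thesis
    using convex_pair_combination[OF assms(1-3), of t] by simp
qed

lemma convex_above:
  fixes A :: "(real \<times> real) set"
  assumes "convex A" "(x1, y1) \<in> A" "(x2, y2) \<in> A" "x1 \<le> x" "x \<le> x2" "h \<le> y1" "h \<le> y2"
  shows "\<exists>y\<ge>h. (x, y) \<in> A"
proof -
  obtain t where t: "0 \<le> t" "t \<le> 1" "x = (1 - t) * x1 + t * x2"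
    using between_as_convex_combination assms(4,5) .
  have "h \<le> (1 - t) * y1 + t * y2"
    using t assms(6,7) convex_bound_le[of "- y1" "- h" "- y2" "1 - t" t] by simp
  then show ?thesis
    using convex_pair_combination[OF assms(1-3), of t] t by blast
qed

text \<open>
  A polygon is the hull of its vertices, so a finite generating set may be replaced by any
  set of points of the polygon that retains the vertices.
\<close>

lemma hull_eqI_extreme:
  fixes S T :: "(real \<times> real) set"
  assumes "finite T" "S \<subseteq> convex hull T" "{x. x extreme_point_of convex hull T} \<subseteq> S"
  shows "convex hull S = convex hull T"
proof
  show "convex hull S \<subseteq> convex hull T" using assms(2) by (simp add: hull_minimal)
  show "convex hull T \<subseteq> convex hull S"
    using Krein_Milman_polytope[OF assms(1)] hull_mono[OF assms(3), of convex] by simp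
qed

section \<open>Equivalent words have equal signatures\<close>

lemma trop_power_NegInf: "(NegInf::trop) ^ n = (if n = 0 then Fin 0 else NegInf)"
  by (cases n) (auto simp: one_trop_def)

lemma trop_power_Fin: "Fin x ^ n = Fin (real n * x)"
  by (induction n) (auto simp: one_trop_def algebra_simps)

lemma trop_add_idem: "(x::trop) + x = x"
  by (cases x) auto

text \<open>
  Tropical addition is the maximum, so \<open>x + y = y\<close> expresses \<open>x \<le> y\<close>. This and the next two
  lemmas are what is needed to compare tropical sums in this form.
\<close>

lemma trop_summand_absorbed:
  fixes f :: "'a \<Rightarrow> trop"
  assumes "finite I" "k \<in> I" shows "f k + sum f I = sum f I"
  using assms by (simp add: sum.remove[of I k] trop_add_idem flip: add.assoc)

lemma trop_sum_absorbed:
  fixes f :: "'a \<Rightarrow> trop"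
  assumes "\<And>k. k \<in> I \<Longrightarrow> f k + t = t" shows "sum f I + t = t"
  using assms
proof (induction I rule: infinite_finite_induct)
  case (insert k I)
  then show ?case by (simp add: add.assoc)
qed (simp_all)

lemma trop_absorb_trans:
  fixes x y z :: trop
  assumes "x + y = y" "y + z = z" shows "x + z = z"
  using assms by (metis add.assoc)

definition word_matrix :: "(letter \<Rightarrow> trop^2^2) \<Rightarrow> letter list \<Rightarrow> trop^2^2" where
  "word_matrix f w = foldr (\<lambda>c M. f c ** M) w (mat 1)"

lemma word_matrix_append: "word_matrix f (u @ v) = word_matrix f u ** word_matrix f v"
  by (induction u) (simp_all add: word_matrix_def matrix_mul_assoc)

lemma word_matrix_single: "word_matrix f [c] = f c"
  by (simp add: word_matrix_def)

lemma UT2_mult: "M \<in> UT2 \<Longrightarrow> N \<in> UT2 \<Longrightarrow> M ** N \<in> UT2"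
  by (cases "M $ 2 $ 2") (simp_all add: UT2_def matrix_matrix_mult_def sum_2)

lemma word_matrix_UT2: "(\<And>c. f c \<in> UT2) \<Longrightarrow> word_matrix f w \<in> UT2"
proof (induction w)
  case Nil
  then show ?case by (simp add: word_matrix_def UT2_def mat_def zero_trop_def)
next
  case (Cons c w)
  then show ?case using UT2_mult[of "f c" "word_matrix f w"] by (simp add: word_matrix_def)
qed

lemma UT2_morphism_word_matrix: "(\<And>c. f c \<in> UT2) \<Longrightarrow> UT2_morphism (word_matrix f)"
  by (simp add: UT2_morphism_def word_matrix_append word_matrix_UT2)

text \<open>
  Words over two letters form a free semigroup, so a morphism is determined by the images of the letters.
\<close>

lemma UT2_morphism_eq_word_matrix:
  assumes "UT2_morphism \<phi>" "w \<noteq> []"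
  shows "\<phi> w = word_matrix (\<lambda>c. \<phi> [c]) w"
  using assms(2)
proof (induction w rule: rev_nonempty_induct)
  case (single c)
  then show ?case by (simp add: word_matrix_single)
next
  case (snoc c w)
  then show ?case
    using assms(1) by (simp add: UT2_morphism_def word_matrix_append word_matrix_single)
qed

lemma sim2_iff_word_matrix:
  assumes "w \<noteq> []" "u \<noteq> []"
  shows "w \<sim>\<^sub>2 u \<longleftrightarrow> (\<forall>f. (\<forall>c. f c \<in> UT2) \<longrightarrow> word_matrix f w = word_matrix f u)"
proof
  assume "w \<sim>\<^sub>2 u"
  then show "\<forall>f. (\<forall>c. f c \<in> UT2) \<longrightarrow> word_matrix f w = word_matrix f u"
    using UT2_morphism_word_matrix by (simp add: sim2_def)
next
  assume R: "\<forall>f. (\<forall>c. f c \<in> UT2) \<longrightarrow> word_matrix f w = word_matrix f u"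
  show "w \<sim>\<^sub>2 u"
    unfolding sim2_def
  proof (intro allI impI)
    fix \<phi> assume \<phi>: "UT2_morphism \<phi>"
    then have "\<forall>c. \<phi> [c] \<in> UT2" by (simp add: UT2_morphism_def)
    then have "word_matrix (\<lambda>c. \<phi> [c]) w = word_matrix (\<lambda>c. \<phi> [c]) u"
      using R by (elim allE[of _ "\<lambda>c. \<phi> [c]"]) simp
    then show "\<phi> w = \<phi> u" using UT2_morphism_eq_word_matrix[OF \<phi>] assms by metis
  qed
qed

lemma sim2_word_matrix:
  assumes "w \<noteq> []" "u \<noteq> []" "w \<sim>\<^sub>2 u" "\<And>c. f c \<in> UT2"
  shows "word_matrix f w = word_matrix f u"
  using assms by (simp add: sim2_iff_word_matrix)

lemma word_matrix_diagonal:
  assumes "\<And>c. f c \<in> UT2" "i = 1 \<or> i = 2"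
  shows "word_matrix f w $ i $ i = (f La $ i $ i) ^ count_list w La * (f Lb $ i $ i) ^ count_list w Lb"
proof (induction w)
  case Nil
  then show ?case by (simp add: word_matrix_def mat_def)
next
  case (Cons c w)
  have "word_matrix f w \<in> UT2" by (rule word_matrix_UT2) (rule assms)
  then have "word_matrix f w $ 2 $ 1 = 0" "f c $ 2 $ 1 = 0"
    using assms(1)[of c] by (simp_all add: UT2_def zero_trop_def)
  then have "(f c ** word_matrix f w) $ i $ i = f c $ i $ i * word_matrix f w $ i $ i"
    using assms(2) by (auto simp: matrix_matrix_mult_def sum_2)
  moreover have "word_matrix f (c # w) = f c ** word_matrix f w" by (simp add: word_matrix_def)
  ultimately show ?case
    using Cons by (cases c) (simp_all add: mult_ac)
qed

text \<open>
  The term of the corner entry that takes its off-diagonal factor from a letter \<open>c\<close> starting at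
  \<open>p\<close>, in a word whose path ends at \<open>N\<close>: the letters before contribute their entries at
  \<open>(1, 1)\<close>, those after contribute their entries at \<open>(2, 2)\<close>. The subtracted ones account for
  the letter \<open>c\<close> itself, which is neither before nor after.
\<close>

definition start_weight ::
    "(letter \<Rightarrow> trop^2^2) \<Rightarrow> nat \<times> nat \<Rightarrow> letter \<Rightarrow> nat \<times> nat \<Rightarrow> trop" where
  "start_weight f N c p =
     f La $ 1 $ 1 ^ fst p * f Lb $ 1 $ 1 ^ snd p * f c $ 1 $ 2 *
     (f La $ 2 $ 2 ^ (fst N - fst p - (if c = La then 1 else 0)) *
      f Lb $ 2 $ 2 ^ (snd N - snd p - (if c = Lb then 1 else 0)))"

lemma start_bounds:
  assumes "q \<in> starts c w"
  shows "fst q + (if c = La then 1 else 0) \<le> count_list w La \<and>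
         snd q + (if c = Lb then 1 else 0) \<le> count_list w Lb"
proof -
  obtain n where n: "n < length w" "w ! n = c" "q = pt w n" using assms by (auto simp: starts_def)
  have "fst (pt w (Suc n)) \<le> count_list w La" "snd (pt w (Suc n)) \<le> count_list w Lb"
    by (rule pt_le_counts)+
  then show ?thesis
    using n pt_Suc[OF n(1)] by (cases c; simp)
qed

lemma start_weight_snoc:
  assumes "p \<in> starts c w"
  shows "start_weight f (pt (w @ [d]) (length (w @ [d]))) c p =
         start_weight f (pt w (length w)) c p * f d $ 2 $ 2"
proof -
  have "x ^ (n - a) = x * x ^ (n - Suc a)" if "Suc a \<le> n" for x :: trop and n a
    using that by (metis Suc_diff_Suc Suc_le_eq power_Suc)
  then show ?thesis
    using start_bounds[OF assms] unfolding start_weight_def pt_length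
    by (cases d; cases c) (simp_all add: Suc_diff_le mult_ac)
qed

lemma word_matrix_corner:
  assumes "\<And>c. f c \<in> UT2"
  shows "word_matrix f w $ 1 $ 2 =
    (\<Sum>n<length w. start_weight f (pt w (length w)) (w ! n) (pt w n))"
proof (induction w rule: rev_induct)
  case Nil
  then show ?case by (simp add: word_matrix_def mat_def)
next
  case (snoc d w)
  have "word_matrix f (w @ [d]) $ 1 $ 2 =
        word_matrix f w $ 1 $ 1 * f d $ 1 $ 2 + word_matrix f w $ 1 $ 2 * f d $ 2 $ 2"
    by (simp add: word_matrix_append word_matrix_single) (simp add: matrix_matrix_mult_def sum_2)
  also have "word_matrix f w $ 1 $ 2 * f d $ 2 $ 2 =
      (\<Sum>n<length w. start_weight f (pt (w @ [d]) (length (w @ [d]))) ((w @ [d]) ! n) (pt (w @ [d]) n))"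
    unfolding snoc.IH sum_distrib_right
  proof (rule sum.cong[OF refl])
    fix n assume "n \<in> {..<length w}"
    then have n: "n < length w" by simp
    then have "(w @ [d]) ! n = w ! n" "pt (w @ [d]) n = pt w n"
      by (simp_all add: nth_append pt_append1)
    then show "start_weight f (pt w (length w)) (w ! n) (pt w n) * f d $ 2 $ 2 =
      start_weight f (pt (w @ [d]) (length (w @ [d]))) ((w @ [d]) ! n) (pt (w @ [d]) n)"
      using start_weight_snoc[OF pt_in_starts[OF n]] by simp
  qed
  also have "word_matrix f w $ 1 $ 1 * f d $ 1 $ 2 =
      start_weight f (pt (w @ [d]) (length (w @ [d]))) ((w @ [d]) ! length w) (pt (w @ [d]) (length w))"
    using word_matrix_diagonal[of f 1 w] assms
    by (cases d) (simp_all add: start_weight_def pt_def)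
  finally show ?case by (simp add: add.commute)
qed

text \<open>
  Points of weight zero are dropped because the argument below needs that every remaining point
  genuinely takes part in the combination.
\<close>

lemma convex_hull_positive_weights:
  fixes S :: "(nat \<times> nat) set"
  assumes "finite S" "real_point p \<in> convex hull (real_point ` S)"
  shows "\<exists>T m. T \<subseteq> S \<and> finite T \<and> (\<forall>q\<in>T. m q > 0) \<and> sum m T = 1 \<and>
    real (fst p) = (\<Sum>q\<in>T. m q * real (fst q)) \<and> real (snd p) = (\<Sum>q\<in>T. m q * real (snd q))"
proof -
  have inj: "inj_on real_point S" by (auto simp: inj_on_def real_point_def prod_eq_iff)
  obtain u where u: "\<forall>x\<in>real_point ` S. 0 \<le> u x" "sum u (real_point ` S) = 1"
      "(\<Sum>x\<in>real_point ` S. u x *\<^sub>R x) = real_point p"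
    using assms by (auto simp: convex_hull_finite)
  define m where "m = u \<circ> real_point"
  define T where "T = {q \<in> S. m q > 0}"
  have "T \<subseteq> S" by (auto simp: T_def)
  have "m q = 0" if "q \<in> S - T" for q
    using that u(1) by (force simp: m_def T_def)
  then have 0: "T \<subseteq> S" "\<forall>q\<in>S - T. m q = 0" "\<forall>q\<in>S - T. m q *\<^sub>R real_point q = 0"
    using \<open>T \<subseteq> S\<close> by simp_all
  have "sum m S = 1" "(\<Sum>q\<in>S. m q *\<^sub>R real_point q) = real_point p"
    using u(2,3) by (simp_all add: sum.reindex[OF inj] m_def)
  moreover have "sum m S = sum m T" "(\<Sum>q\<in>S. m q *\<^sub>R real_point q) = (\<Sum>q\<in>T. m q *\<^sub>R real_point q)"
    using 0 by (intro sum.mono_neutral_right[OF assms(1)]; simp)+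
  ultimately have "sum m T = 1" and eq: "(\<Sum>q\<in>T. m q *\<^sub>R real_point q) = real_point p"
    by simp_all
  have "real (fst p) = (\<Sum>q\<in>T. m q * real (fst q))" "real (snd p) = (\<Sum>q\<in>T. m q * real (snd q))"
    using arg_cong[OF eq, of fst] arg_cong[OF eq, of snd]
    by (simp_all add: fst_sum snd_sum real_point_def)
  moreover have "finite T" "\<forall>q\<in>T. m q > 0" using assms(1) by (simp_all add: T_def)
  ultimately show ?thesis using \<open>T \<subseteq> S\<close> \<open>sum m T = 1\<close> by blast
qed

lemma positive_combination_zero:
  fixes m g :: "'a \<Rightarrow> real"
  assumes "finite T" "\<And>q. q \<in> T \<Longrightarrow> m q > 0" "\<And>q. q \<in> T \<Longrightarrow> g q \<ge> 0"
    "(\<Sum>q\<in>T. m q * g q) = 0" "q \<in> T"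
  shows "g q = 0"
proof -
  have "\<forall>q\<in>T. m q * g q = 0"
    using assms(1-4) by (subst (asm) sum_nonneg_eq_0_iff) (auto intro: mult_nonneg_nonneg less_imp_le)
  then show ?thesis using assms(2,5) by force
qed

text \<open>
  The \<open>0\<close> in the second case is arbitrary: it is multiplied by the exponent \<open>0\<close>.
\<close>

lemma trop_power_eq_Fin:
  assumes "x = NegInf \<Longrightarrow> k = 0"
  shows "x ^ k = Fin (real k * (case x of Fin a \<Rightarrow> a | NegInf \<Rightarrow> 0))"
  using assms by (cases x) (auto simp: trop_power_Fin one_trop_def)

text \<open>
  If the entries on and above the diagonal are real, the weight is an affine function of the point, and an affine function at
  \<open>p\<close> is at most its maximum over any set whose hull contains \<open>p\<close>. If a diagonal entry
  is minus infinity, the weight is real only on the line where its exponent vanishes; if the corner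
  entry is, the weight is never real. The exponents are
  nonnegative affine functions, so if one vanishes at \<open>p\<close>, it vanishes at every point that
  occurs in \<open>p\<close> with positive weight, and the affine argument applies to those points.
\<close>

lemma start_weight_dominated:
  assumes fin: "finite S" and S: "\<And>q. q \<in> S \<Longrightarrow> fst q + (if c = La then 1 else 0) \<le> fst N \<and>
            snd q + (if c = Lb then 1 else 0) \<le> snd N"
    and p: "real_point p \<in> convex hull (real_point ` S)"
    and pN: "fst p + (if c = La then 1 else 0) \<le> fst N" "snd p + (if c = Lb then 1 else 0) \<le> snd N"
  shows "\<exists>q\<in>S. start_weight f N c p + start_weight f N c q = start_weight f N c q"
proof -
  obtain T m where T: "T \<subseteq> S" "finite T" "\<forall>q\<in>T. m q > 0" "sum m T = 1"
    and p1: "real (fst p) = (\<Sum>q\<in>T. m q * real (fst q))"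
    and p2: "real (snd p) = (\<Sum>q\<in>T. m q * real (snd q))"
    using convex_hull_positive_weights[OF fin p] by blast
  define a where "a = fst N - (if c = La then 1 else 0)"
  define b where "b = snd N - (if c = Lb then 1 else 0)"
  define val :: "trop \<Rightarrow> real" where "val x = (case x of Fin a \<Rightarrow> a | NegInf \<Rightarrow> 0)" for x
  have weight: "start_weight f N c q =
      f La $ 1 $ 1 ^ fst q * f Lb $ 1 $ 1 ^ snd q * f c $ 1 $ 2 *
      (f La $ 2 $ 2 ^ (a - fst q) * f Lb $ 2 $ 2 ^ (b - snd q))" for q
    by (simp add: start_weight_def a_def b_def diff_commute)
  have le: "fst q \<le> a" "snd q \<le> b" if "q \<in> S" for q
    using S[OF that] by (auto simp: a_def b_def)
  have ple: "fst p \<le> a" "snd p \<le> b"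
    using pN by (auto simp: a_def b_def)
  define L where "L q = real (fst q) * val (f La $ 1 $ 1) + real (snd q) * val (f Lb $ 1 $ 1)
      + val (f c $ 1 $ 2) + (real (a - fst q) * val (f La $ 2 $ 2) + real (b - snd q) * val (f Lb $ 2 $ 2))"
    for q
  define ok where "ok q \<longleftrightarrow> (f La $ 1 $ 1 = NegInf \<longrightarrow> fst q = 0) \<and> (f Lb $ 1 $ 1 = NegInf \<longrightarrow> snd q = 0) \<and>
      f c $ 1 $ 2 \<noteq> NegInf \<and> (f La $ 2 $ 2 = NegInf \<longrightarrow> a - fst q = 0) \<and>
      (f Lb $ 2 $ 2 = NegInf \<longrightarrow> b - snd q = 0)" for q
  have okL: "start_weight f N c q = Fin (L q)" if okq: "ok q" for q
  proof -
    obtain y where y: "f c $ 1 $ 2 = Fin y"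
      using okq by (cases "f c $ 1 $ 2") (auto simp: ok_def)
    have "f La $ 1 $ 1 ^ fst q = Fin (real (fst q) * val (f La $ 1 $ 1))"
      "f Lb $ 1 $ 1 ^ snd q = Fin (real (snd q) * val (f Lb $ 1 $ 1))"
      "f La $ 2 $ 2 ^ (a - fst q) = Fin (real (a - fst q) * val (f La $ 2 $ 2))"
      "f Lb $ 2 $ 2 ^ (b - snd q) = Fin (real (b - snd q) * val (f Lb $ 2 $ 2))"
      using okq unfolding ok_def val_def by (blast intro: trop_power_eq_Fin)+
    then show ?thesis by (simp add: weight L_def y) (simp add: val_def)
  qed
  have mult_NegInf: "x * NegInf = NegInf" for x by (cases x) auto
  have notok: "start_weight f N c q = NegInf" if "\<not> ok q" for q
    using that unfolding weight ok_def by (auto simp: trop_power_NegInf mult_NegInf)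
  have "T \<noteq> {}" using T(4) by auto
  then obtain q0 where q0: "q0 \<in> T" by blast
  have pa: "real (a - fst p) = (\<Sum>q\<in>T. m q * real (a - fst q))"
  proof -
    have "(\<Sum>q\<in>T. m q * real (a - fst q)) = (\<Sum>q\<in>T. m q * real a - m q * real (fst q))"
      using le T(1) by (intro sum.cong) (auto simp: of_nat_diff algebra_simps)
    also have "\<dots> = real a - real (fst p)"
      by (simp only: sum_subtractf p1 T(4) mult_1_left flip: sum_distrib_right)
    finally show ?thesis using ple by simp
  qed
  have pb: "real (b - snd p) = (\<Sum>q\<in>T. m q * real (b - snd q))"
  proof -
    have "(\<Sum>q\<in>T. m q * real (b - snd q)) = (\<Sum>q\<in>T. m q * real b - m q * real (snd q))"
      using le T(1) by (intro sum.cong) (auto simp: of_nat_diff algebra_simps)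
    also have "\<dots> = real b - real (snd p)"
      by (simp only: sum_subtractf p2 T(4) mult_1_left flip: sum_distrib_right)
    finally show ?thesis using ple by simp
  qed
  show ?thesis
  proof (cases "ok p")
    case False
    then show ?thesis using notok[OF False] q0 T(1) by (intro bexI[of _ q0]) auto
  next
    case True
    \<comment> \<open>Each of the four exponents, as a function of the point, satisfies the first premise.\<close>
    have vanish: "g q = 0" if "real (g p) = (\<Sum>q\<in>T. m q * real (g q))" "g p = 0" "q \<in> T"
      for g :: "nat \<times> nat \<Rightarrow> nat" and q
    proof -
      have "(\<Sum>q\<in>T. m q * real (g q)) = 0" using that(1,2) by simp
      then have "real (g q) = 0"
        using T(3) by (intro positive_combination_zero[OF T(2) _ _ _ that(3)]) auto
      then show ?thesis by simp
    qed
    have ok: "ok q" if "q \<in> T" for q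
      using True vanish[of fst, OF p1 _ that] vanish[of snd, OF p2 _ that]
        vanish[of "\<lambda>q. a - fst q", OF pa _ that] vanish[of "\<lambda>q. b - snd q", OF pb _ that]
      unfolding ok_def by blast
    have "\<exists>q\<in>T. L p \<le> L q"
    proof (rule ccontr)
      assume "\<not> (\<exists>q\<in>T. L p \<le> L q)"
      then have "(\<Sum>q\<in>T. m q * L q) < (\<Sum>q\<in>T. m q * L p)"
        using T q0 by (intro sum_strict_mono) auto
      also have "\<dots> = L p" by (simp only: T(4) mult_1_left flip: sum_distrib_right)
      also have "(\<Sum>q\<in>T. m q * L q) = L p"
      proof -
        have "(\<Sum>q\<in>T. m q * L q) =
            (\<Sum>q\<in>T. m q * real (fst q)) * val (f La $ 1 $ 1) +
            (\<Sum>q\<in>T. m q * real (snd q)) * val (f Lb $ 1 $ 1) +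
            (\<Sum>q\<in>T. m q) * val (f c $ 1 $ 2) +
            ((\<Sum>q\<in>T. m q * real (a - fst q)) * val (f La $ 2 $ 2) +
             (\<Sum>q\<in>T. m q * real (b - snd q)) * val (f Lb $ 2 $ 2))"
          by (simp only: L_def distrib_left sum.distrib sum_distrib_right mult.assoc)
        then show ?thesis
          unfolding p1[symmetric] p2[symmetric] pa[symmetric] pb[symmetric] T(4) by (simp add: L_def)
      qed
      finally show False by simp
    qed
    then obtain q where q: "q \<in> T" "L p \<le> L q" by blast
    then have "start_weight f N c p + start_weight f N c q = start_weight f N c q"
      by (simp add: okL[OF True] okL[OF ok])
    then show ?thesis using q(1) T(1) by blast
  qed
qed

text \<open>
  One half of the comparison of support functions: among words with the same end point, larger hulls
  give the larger corner entry.
\<close>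

lemma word_matrix_corner_absorbed:
  assumes f: "\<And>c. f c \<in> UT2" and N: "pt w (length w) = pt u (length u)"
    and sub: "\<And>c. real_point ` starts c w \<subseteq> hull_of c u"
  shows "word_matrix f w $ 1 $ 2 + word_matrix f u $ 1 $ 2 = word_matrix f u $ 1 $ 2"
  unfolding word_matrix_corner[OF f, where w=w]
proof (rule trop_sum_absorbed)
  fix n assume "n \<in> {..<length w}"
  then have n: "n < length w" by simp
  define c where "c = w ! n"
  have p: "pt w n \<in> starts c w" using n by (simp add: c_def pt_in_starts)
  have "\<exists>q\<in>starts c u. start_weight f (pt u (length u)) c (pt w n) + start_weight f (pt u (length u)) c q =
          start_weight f (pt u (length u)) c q"
  proof (rule start_weight_dominated)
    show "real_point (pt w n) \<in> hull_of c u" using sub p by blast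
    show "fst (pt w n) + (if c = La then 1 else 0) \<le> fst (pt u (length u))"
         "snd (pt w n) + (if c = Lb then 1 else 0) \<le> snd (pt u (length u))"
      using start_bounds[OF p] N by (simp_all add: pt_length)
  qed (use start_bounds in \<open>auto simp: pt_length\<close>)
  then obtain k where k: "k < length u" "u ! k = c" and
    absorbed: "start_weight f (pt u (length u)) c (pt w n) + start_weight f (pt u (length u)) c (pt u k) =
     start_weight f (pt u (length u)) c (pt u k)"
    by (auto simp: starts_def)
  have "start_weight f (pt u (length u)) c (pt u k) + word_matrix f u $ 1 $ 2 = word_matrix f u $ 1 $ 2"
    unfolding word_matrix_corner[OF f]
    using trop_summand_absorbed[of "{..<length u}" k "\<lambda>n. start_weight f (pt u (length u)) (u ! n) (pt u n)"] k
    by simp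
  with absorbed have "start_weight f (pt u (length u)) c (pt w n) + word_matrix f u $ 1 $ 2 = word_matrix f u $ 1 $ 2"
    by (rule trop_absorb_trans)
  then show "start_weight f (pt w (length w)) (w ! n) (pt w n) + word_matrix f u $ 1 $ 2 = word_matrix f u $ 1 $ 2"
    by (simp only: N c_def)
qed

text \<open>
  Matrices whose corner entry evaluates the linear functional \<open>(x, y)\<close> at the starts of the steps
  \<open>d\<close>; the other letter has minus infinity in the corner, which removes its starts from the sum.
\<close>

definition functional_matrix :: "real \<Rightarrow> real \<Rightarrow> letter \<Rightarrow> letter \<Rightarrow> trop^2^2" where
  "functional_matrix x y d c =
     vector [vector [Fin (if c = La then x else y), if c = d then Fin 0 else NegInf],
             vector [NegInf, Fin 0]]"

lemma functional_matrix_UT2: "functional_matrix x y d c \<in> UT2"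
  by (simp add: functional_matrix_def UT2_def)

lemma start_weight_functional_matrix:
  "start_weight (functional_matrix x y d) N c p =
     (if c = d then Fin (inner (x, y) (real_point p)) else NegInf)"
  by (simp add: start_weight_def functional_matrix_def trop_power_Fin real_point_def mult.commute)

text \<open>
  A start of \<open>w\<close> outside the hull for \<open>u\<close> could be separated from it by a line; the matrices that
  evaluate the separating functional would then distinguish the two words.
\<close>

lemma sim2_imp_starts_subset:
  assumes "w \<noteq> []" "u \<noteq> []" "w \<sim>\<^sub>2 u"
  shows "real_point ` starts c w \<subseteq> hull_of c u"
proof (rule subsetI, rule ccontr)
  fix x assume "x \<in> real_point ` starts c w" and out: "x \<notin> hull_of c u"
  then obtain n where n: "n < length w" "w ! n = c" "x = real_point (pt w n)"
    by (auto simp: starts_def)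
  have "closed (hull_of c u)"
    by (intro compact_imp_closed compact_convex_hull finite_imp_compact) simp
  then obtain d b where d: "inner d x < b" "\<And>y. y \<in> hull_of c u \<Longrightarrow> b < inner d y"
    using separating_hyperplane_closed_point[of "hull_of c u" x] out by auto
  \<comment> \<open>The separation puts \<open>x\<close> on the smaller side, whereas the corner entry is a maximum.\<close>
  define f where "f = functional_matrix (- fst d) (- snd d) c"
  have f: "f c \<in> UT2" for c by (simp add: f_def functional_matrix_UT2)
  have weight: "start_weight f N e p = (if e = c then Fin (- inner d (real_point p)) else NegInf)" for N e p
    by (cases d) (simp add: f_def start_weight_functional_matrix real_point_def)
  have eq: "word_matrix f w $ 1 $ 2 = word_matrix f u $ 1 $ 2"
    using sim2_word_matrix[OF assms f] by simp
  have "Fin (- inner d x) + word_matrix f w $ 1 $ 2 = word_matrix f w $ 1 $ 2"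
    unfolding word_matrix_corner[OF f]
    using trop_summand_absorbed[of "{..<length w}" n "\<lambda>n. start_weight f (pt w (length w)) (w ! n) (pt w n)"] n
    by (simp add: weight)
  moreover have "word_matrix f u $ 1 $ 2 + Fin (- b) = Fin (- b)"
    unfolding word_matrix_corner[OF f]
  proof (rule trop_sum_absorbed)
    fix k assume "k \<in> {..<length u}"
    then have "real_point (pt u k) \<in> hull_of (u ! k) u"
      using pt_in_starts[of k u] by (simp add: hull_inc)
    then show "start_weight f (pt u (length u)) (u ! k) (pt u k) + Fin (- b) = Fin (- b)"
      using d(2)[of "real_point (pt u k)"] by (auto simp: weight)
  qed
  ultimately have "Fin (- inner d x) + Fin (- b) = Fin (- b)"
    unfolding eq by (rule trop_absorb_trans)
  then show False using d(1) by simp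
qed

lemma sim2_imp_counts:
  assumes "w \<noteq> []" "u \<noteq> []" "w \<sim>\<^sub>2 u"
  shows "pt w (length w) = pt u (length u)"
proof -
  have *: "Fin (x * real (count_list w La) + y * real (count_list w Lb)) =
        Fin (x * real (count_list u La) + y * real (count_list u Lb))" for x y
  proof -
    let ?f = "functional_matrix x y La"
    have "word_matrix ?f w = word_matrix ?f u"
      by (rule sim2_word_matrix[OF assms functional_matrix_UT2])
    then show ?thesis
      using word_matrix_diagonal[of ?f 1 w] word_matrix_diagonal[of ?f 1 u]
      by (simp add: functional_matrix_UT2) (simp add: functional_matrix_def trop_power_Fin mult.commute)
  qed
  show ?thesis using *[of 1 0] *[of 0 1] by (simp add: pt_length)
qed

lemma sim2_iff_signature:
  assumes "w \<noteq> []" "u \<noteq> []"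
  shows "w \<sim>\<^sub>2 u \<longleftrightarrow> pt w (length w) = pt u (length u) \<and> signature w = signature u"
proof
  assume sim: "w \<sim>\<^sub>2 u"
  then have "u \<sim>\<^sub>2 w" unfolding sim2_def by metis
  then have "hull_of c w = hull_of c u" for c
    using sim assms by (intro equalityI hull_minimal sim2_imp_starts_subset) auto
  then show "pt w (length w) = pt u (length u) \<and> signature w = signature u"
    using sim2_imp_counts[OF assms sim] by (simp add: signature_eq)
next
  assume R: "pt w (length w) = pt u (length u) \<and> signature w = signature u"
  then have hull: "hull_of c w = hull_of c u" for c by (cases c) (simp_all add: signature_eq)
  have sub: "real_point ` starts c w \<subseteq> hull_of c u" for c
    unfolding hull[symmetric] by (rule hull_subset)
  have sub': "real_point ` starts c u \<subseteq> hull_of c w" for c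
    unfolding hull by (rule hull_subset)
  show "w \<sim>\<^sub>2 u"
    unfolding sim2_iff_word_matrix[OF assms]
  proof (intro allI impI)
    fix f :: "letter \<Rightarrow> trop^2^2" assume "\<forall>c. f c \<in> UT2"
    then have f: "f c \<in> UT2" for c by blast
    have "word_matrix f w $ 1 $ 2 + word_matrix f u $ 1 $ 2 = word_matrix f u $ 1 $ 2"
      by (rule word_matrix_corner_absorbed[OF f _ sub]) (use R in simp)
    moreover have "word_matrix f u $ 1 $ 2 + word_matrix f w $ 1 $ 2 = word_matrix f w $ 1 $ 2"
      by (rule word_matrix_corner_absorbed[OF f _ sub']) (use R in simp)
    ultimately have "word_matrix f w $ 1 $ 2 = word_matrix f u $ 1 $ 2"
      by (simp add: add.commute)
    moreover have "word_matrix f w $ i $ i = word_matrix f u $ i $ i" if "i = 1 \<or> i = 2" for i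
      using word_matrix_diagonal[OF f that] R by (simp add: pt_length)
    moreover have "word_matrix f w $ 2 $ 1 = word_matrix f u $ 2 $ 1"
      using word_matrix_UT2[OF f] by (simp add: UT2_def)
    ultimately show "word_matrix f w = word_matrix f u"
      by (simp add: vec_eq_iff forall_2)
  qed
qed

section \<open>Maximal words exist\<close>

lemma path_le_trans: "u \<preceq> v \<Longrightarrow> v \<preceq> w \<Longrightarrow> u \<preceq> w"
  unfolding path_le_def by (metis le_trans)

text \<open>
  The order compares heights over the same column. Comparing instead after the same number of
  letters makes antisymmetry immediate, because a word can be read off from the heights of its prefixes.
\<close>

lemma path_le_prefix:
  assumes "u \<preceq> v" "n \<le> length u"
  shows "n \<le> length v \<and> snd (pt u n) \<le> snd (pt v n)"
proof -
  have "pt u n \<in> word_path u" using assms(2) by (simp add: word_path_eq)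
  then obtain q where q: "q \<in> word_path v" "fst q = fst (pt u n)" "snd (pt u n) \<le> snd q"
    using assms(1) unfolding path_le_def by blast
  then obtain m where m: "m \<le> length v" "fst (pt v m) = fst (pt u n)" "snd (pt u n) \<le> snd (pt v m)"
    by (auto simp: word_path_eq)
  then have "n \<le> m" using pt_sum[of n u] pt_sum[of m v] assms(2) by linarith
  moreover from this have "fst (pt v n) \<le> fst (pt u n)" using m(2) by (metis pt_fst_mono)
  ultimately show ?thesis using m pt_sum[of n u] pt_sum[of n v] assms(2) by linarith
qed

lemma length_eq_if_endpoint_eq: "pt u (length u) = pt w (length w) \<Longrightarrow> length u = length w"
  by (metis le_refl pt_sum)

lemma path_le_antisym:
  assumes "u \<preceq> v" "v \<preceq> u" shows "u = v"
proof (rule nth_equalityI)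
  show len: "length u = length v"
    using path_le_prefix[OF assms(1), of "length u"] path_le_prefix[OF assms(2), of "length v"] by simp
  fix n assume n: "n < length u"
  have pt: "pt u k = pt v k" if "k \<le> length u" for k
    using path_le_prefix[OF assms(1), of k] path_le_prefix[OF assms(2), of k] that len
      pt_sum[of k u] pt_sum[of k v] by (simp add: prod_eq_iff)
  show "u ! n = v ! n"
    using pt[of n] pt[of "Suc n"] n len pt_Suc[of n u] pt_Suc[of n v]
    by (cases "u ! n"; cases "v ! n") auto
qed

lemma word_path_inject: "word_path u = word_path v \<Longrightarrow> u = v"
  by (rule path_le_antisym) (auto simp: path_le_def)

lemma finite_words_length: "finite {u :: letter list. length u = n}"
proof -
  have "c \<in> {La, Lb}" for c by (cases c) auto
  then have "(UNIV :: letter set) \<subseteq> {La, Lb}" by blast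
  then have "finite (UNIV :: letter set)" by (rule finite_subset) simp
  from finite_lists_length_eq[OF this, of n] show ?thesis by simp
qed

lemma mem_sim2_class_iff:
  assumes "w \<noteq> []"
  shows "u \<in> sim2_class w \<longleftrightarrow>
    pt u (length u) = pt w (length w) \<and> signature u = signature w"
proof (cases "u = []")
  case True
  then show ?thesis
    using assms length_eq_if_endpoint_eq[of u w] by (auto simp: sim2_class_def)
next
  case False
  then show ?thesis using sim2_iff_signature[OF assms False] by (auto simp: sim2_class_def)
qed

lemma maximal_in_class_exists:
  assumes "w \<noteq> []" shows "\<exists>v. maximal_in_class w v"
proof -
  let ?R = "\<lambda>u v. u \<preceq> v \<and> u \<noteq> v"
  have "sim2_class w \<subseteq> {u. length u = length w}"
    using assms length_eq_if_endpoint_eq by (auto simp: mem_sim2_class_iff)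
  then have "finite (sim2_class w)" using finite_words_length finite_subset by blast
  moreover have "sim2_class w \<noteq> {}" using mem_sim2_class_iff[OF assms, of w] by blast
  moreover have "asymp_on (sim2_class w) ?R" "transp_on (sim2_class w) ?R"
    using path_le_antisym path_le_trans by (auto intro!: asymp_onI transp_onI)
  ultimately obtain v where "v \<in> sim2_class w" "\<forall>u\<in>sim2_class w. u \<noteq> v \<longrightarrow> \<not> ?R v u"
    using Finite_Set.bex_max_element[of "sim2_class w" ?R] by blast
  then show ?thesis by (auto simp: maximal_in_class_def)
qed

section \<open>Moving an up step to the left\<close>

lemma count_list_replicate: "count_list (replicate n c) d = (if c = d then n else 0)"
  by (induction n) auto

lemma pt_replicate: "k \<le> n \<Longrightarrow> pt (replicate n La) k = (k, 0)"
  by (simp add: pt_def count_list_replicate min_absorb1)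

lemma starts_replicate: "starts c (replicate n La) = (if c = La then (\<lambda>k. (k, 0)) ` {..<n} else {})"
proof -
  have "starts La (replicate n La) = pt (replicate n La) ` {..<n}" by (auto simp: starts_def)
  also have "\<dots> = (\<lambda>k. (k, 0)) ` {..<n}" by (rule image_cong) (auto simp: pt_replicate)
  finally show ?thesis by (cases c) (auto simp: starts_def)
qed

lemma starts_La_power_Lb:
  "starts La (replicate n La @ [Lb]) = (\<lambda>k. (k, 0)) ` {..<n}"
  "starts Lb (replicate n La @ [Lb]) = {(n, 0)}"
  by (auto simp: starts_append starts_replicate starts_single pt_replicate)

lemma starts_Lb_La_power:
  "starts La (Lb # replicate n La) = (\<lambda>k. (k, 1)) ` {..<n}"
  "starts Lb (Lb # replicate n La) = {(0, 0)}"
proof -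
  have 1: "Lb # replicate n La = [Lb] @ replicate n La" by simp
  have 2: "pt [Lb] (length [Lb]) = (0, 1)" by (simp add: pt_def)
  show "starts La (Lb # replicate n La) = (\<lambda>k. (k, 1)) ` {..<n}"
  "starts Lb (Lb # replicate n La) = {(0, 0)}"
    unfolding 1 starts_append 2 by (auto simp: starts_replicate starts_single image_image)
qed

lemma starts_swap_cong:
  assumes "pt m (length m) = pt m' (length m')"
  shows "starts c (s @ m' @ t) = starts c s \<union> (+) (pt s (length s)) ` starts c m' \<union>
         (+) (pt s (length s)) ` (+) (pt m (length m)) ` starts c t"
  unfolding starts_append image_Un assms by (simp only: Un_assoc)

text \<open>
  Both factors lead from \<open>(0, 0)\<close> to \<open>(n, 1)\<close>, and the second one climbs first.
\<close>

lemma path_le_swap: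
  "s @ (replicate n La @ [Lb]) @ t \<preceq> s @ (Lb # replicate n La) @ t"
proof -
  let ?m = "replicate n La @ [Lb]" and ?m' = "Lb # replicate n La"
  have pt: "pt ?m' (length ?m') = pt ?m (length ?m)"
    unfolding pt_length by (simp add: count_list_replicate)
  have path: "word_path ?m = (\<lambda>k. (k, 0)) ` {..n} \<union> {(n, 1)}"
  proof -
    have "word_path ?m = pt ?m ` {..n} \<union> {pt ?m (Suc n)}"
      by (auto simp: word_path_eq atMost_Suc)
    moreover have "pt ?m ` {..n} = (\<lambda>k. (k, 0)) ` {..n}"
      by (rule image_cong) (auto simp: pt_append1 pt_replicate)
    moreover have "pt ?m (Suc n) = (n, 1)"
      using pt_length[of ?m] by (simp add: count_list_replicate)
    ultimately show ?thesis by simp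
  qed
  have path': "(k, 1) \<in> word_path ?m'" if "k \<le> n" for k
    using that
    by (auto simp: word_path_eq pt_def count_list_replicate intro!: image_eqI[of _ _ "Suc k"])
  define z where "z = pt s (length s)"
  define Q where "Q = (+) z ` (+) (pt ?m (length ?m)) ` word_path t"
  have old: "word_path (s @ ?m @ t) = word_path s \<union> (+) z ` word_path ?m \<union> Q"
    unfolding Q_def z_def word_path_append[of s] word_path_append[of ?m t] image_Un by (simp only: Un_assoc)
  have new: "word_path (s @ ?m' @ t) = word_path s \<union> (+) z ` word_path ?m' \<union> Q"
    unfolding Q_def z_def word_path_append[of s] word_path_append[of ?m' t] image_Un pt by (simp only: Un_assoc)
  have "\<exists>q\<in>(+) z ` word_path ?m'. fst q = fst p \<and> snd p \<le> snd q" if p: "p \<in> (+) z ` word_path ?m" for p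
  proof -
    obtain k where k: "k \<le> n" "fst p = fst z + k" "snd p \<le> snd z + 1"
    proof -
      obtain q where "q \<in> word_path ?m" "p = z + q" using p by blast
      then have "fst q \<le> n" "fst p = fst z + fst q" "snd p \<le> snd z + 1" unfolding path by auto
      then show thesis by (rule that)
    qed
    then show ?thesis using path'[of k] by (intro bexI[of _ "z + (k, 1)"]) auto
  qed
  then show ?thesis
    unfolding path_le_def old new by (intro ballI) (elim UnE; blast)
qed

section \<open>Maximal words cannot be raised\<close>

lemma real_point_inject: "real_point p = real_point q \<longleftrightarrow> p = q"
  by (auto simp: real_point_def prod_eq_iff)

lemma vertices_hull_subset: "vertices (convex hull (real_point ` S)) \<subseteq> S"
proof
  fix p assume "p \<in> vertices (convex hull (real_point ` S))"
  then have "real_point p \<in> real_point ` S"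
    unfolding vertices_def by (blast dest: extreme_point_of_convex_hull)
  then show "p \<in> S" by (auto simp: real_point_inject)
qed

lemma pt_run_La:
  assumes "k \<le> j" "j \<le> length w" "\<And>l. k \<le> l \<Longrightarrow> l < j \<Longrightarrow> w ! l = La"
  shows "pt w j = (fst (pt w k) + (j - k), snd (pt w k))"
  using assms
proof (induction j rule: dec_induct)
  case (step j)
  then show ?case using pt_Suc[of j w] by simp
qed simp

lemma pt_run_Lb:
  assumes "k \<le> j" "j \<le> length w" "\<And>l. k \<le> l \<Longrightarrow> l < j \<Longrightarrow> w ! l = Lb"
  shows "pt w j = (fst (pt w k), snd (pt w k) + (j - k))"
  using assms
proof (induction j rule: dec_induct)
  case (step j)
  then show ?case using pt_Suc[of j w] by simp
qed simp

lemma next_La: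
  assumes "fst (pt w k) < fst (pt w m)" "m \<le> length w"
  obtains j where "k \<le> j" "j < m" "w ! j = La" "\<And>l. k \<le> l \<Longrightarrow> l < j \<Longrightarrow> w ! l = Lb"
proof -
  have km: "k \<le> m" using assms(1) pt_fst_mono[of m k w] by linarith
  have "\<exists>j. k \<le> j \<and> j < m \<and> w ! j = La"
  proof (rule ccontr)
    assume "\<not> ?thesis"
    then have "w ! l = Lb" if "k \<le> l" "l < m" for l using that by (cases "w ! l") auto
    then show False using pt_run_Lb[OF km assms(2)] assms(1) by simp
  qed
  then obtain j where j: "k \<le> j \<and> j < m \<and> w ! j = La"
    and least: "\<And>l. l < j \<Longrightarrow> \<not> (k \<le> l \<and> l < m \<and> w ! l = La)"
    using exists_least_iff[of "\<lambda>j. k \<le> j \<and> j < m \<and> w ! j = La"] by blast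
  have "w ! l = Lb" if "k \<le> l" "l < j" for l
    using least[of l] that j by (cases "w ! l") auto
  then show ?thesis using that j by blast
qed

lemma next_Lb:
  assumes "snd (pt w k) < snd (pt w m)" "m \<le> length w"
  obtains j where "k \<le> j" "j < m" "w ! j = Lb" "\<And>l. k \<le> l \<Longrightarrow> l < j \<Longrightarrow> w ! l = La"
proof -
  have km: "k \<le> m" using assms(1) pt_snd_mono[of m k w] by linarith
  have "\<exists>j. k \<le> j \<and> j < m \<and> w ! j = Lb"
  proof (rule ccontr)
    assume "\<not> ?thesis"
    then have "w ! l = La" if "k \<le> l" "l < m" for l using that by (cases "w ! l") auto
    then show False using pt_run_La[OF km assms(2)] assms(1) by simp
  qed
  then obtain j where j: "k \<le> j \<and> j < m \<and> w ! j = Lb"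
    and least: "\<And>l. l < j \<Longrightarrow> \<not> (k \<le> l \<and> l < m \<and> w ! l = Lb)"
    using exists_least_iff[of "\<lambda>j. k \<le> j \<and> j < m \<and> w ! j = Lb"] by blast
  have "w ! l = La" if "k \<le> l" "l < j" for l
    using least[of l] that j by (cases "w ! l") auto
  then show ?thesis using that j by blast
qed

lemma start_in_hull: "n < length w \<Longrightarrow> w ! n = c \<Longrightarrow> real_point (pt w n) \<in> hull_of c w"
  using pt_in_starts[of n w] by (simp add: hull_inc)

text \<open>
  The functional weighs the first coordinate so heavily that it is minimal on the last column,
  where it then picks the lowest point.
\<close>

lemma last_column_bottom_extreme:
  assumes "0 < j" "j < length w" "w ! (j - 1) = La" "\<And>l. j \<le> l \<Longrightarrow> l < length w \<Longrightarrow> w ! l = Lb"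
  shows "pt w j \<in> vertices (hull_of Lb w)"
  unfolding vertices_def mem_Collect_eq
proof (rule strict_minimum_extreme)
  let ?X = "real (fst (pt w j))" and ?Y = "real (snd (pt w j))"
  \<comment> \<open>Heights are nonnegative, so one column costs more than the height \<open>?Y\<close> can gain.\<close>
  let ?d = "(- (?Y + 1), 1) :: real \<times> real"
  show "real_point (pt w j) \<in> real_point ` starts Lb w"
    using assms(2) assms(4)[of j] by (simp add: pt_in_starts_iff)
  fix y assume "y \<in> real_point ` starts Lb w" and ne: "y \<noteq> real_point (pt w j)"
  then obtain l where l: "l < length w" "w ! l = Lb" "y = real_point (pt w l)"
    by (auto simp: starts_def)
  show "inner ?d (real_point (pt w j)) < inner ?d y"
  proof (cases "l < j")
    case True
    then have "l \<le> j - 1" by simp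
    then have "fst (pt w l) \<le> fst (pt w (j - 1))" by (rule pt_fst_mono)
    moreover have "fst (pt w j) = Suc (fst (pt w (j - 1)))"
      using pt_Suc[of "j - 1" w] assms(1-3) by simp
    ultimately have "real (fst (pt w l)) + 1 \<le> ?X" by simp
    then have "(?Y + 1) * (real (fst (pt w l)) + 1) \<le> (?Y + 1) * ?X"
      by (intro mult_left_mono) auto
    then show ?thesis
      by (simp add: l(3) real_point_def algebra_simps)
  next
    case False
    then have "pt w l = (fst (pt w j), snd (pt w j) + (l - j))"
      using assms(4) l(1) by (intro pt_run_Lb) auto
    moreover have "l \<noteq> j" using ne l(3) by auto
    ultimately show ?thesis using False by (simp add: l(3) real_point_def)
  qed
qed simp

lemma first_point_extreme:
  assumes "0 < length w"
  shows "pt w 0 \<in> vertices (hull_of (w ! 0) w)"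
  unfolding vertices_def mem_Collect_eq
proof (rule strict_minimum_extreme)
  show "real_point (pt w 0) \<in> real_point ` starts (w ! 0) w"
    using assms by (simp only: pt_in_starts image_eqI)
  fix y assume "y \<in> real_point ` starts (w ! 0) w" and ne: "y \<noteq> real_point (pt w 0)"
  then obtain l where "l < length w" "y = real_point (pt w l)"
    by (auto simp: starts_def)
  moreover from this ne have "l \<noteq> 0" by (intro notI) simp
  ultimately show "inner (1, 1) (real_point (pt w 0)) < inner (1, 1) y"
    using pt_sum[of l w] by (simp add: real_point_def flip: of_nat_add)
qed simp

lemma straight_box:
  assumes "k \<le> j" "j \<le> length w" "\<And>l. k \<le> l \<Longrightarrow> l < j \<Longrightarrow> w ! l = w ! k"
  shows "{pt w k..pt w j} = pt w ` {k..j}"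
proof
  show "pt w ` {k..j} \<subseteq> {pt w k..pt w j}" using pt_mono by auto
  show "{pt w k..pt w j} \<subseteq> pt w ` {k..j}"
  proof
    fix p assume p: "p \<in> {pt w k..pt w j}"
    define i where "i = k + (fst p - fst (pt w k)) + (snd p - snd (pt w k))"
    have ki: "k \<le> i" by (simp add: i_def)
    have "p = pt w i \<and> i \<le> j"
    proof (cases "w ! k")
      case La
      then have run: "l < j \<Longrightarrow> k \<le> l \<Longrightarrow> w ! l = La" for l using assms(3)[of l] by simp
      have "pt w j = (fst (pt w k) + (j - k), snd (pt w k))"
        using run assms(1,2) by (intro pt_run_La) auto
      then have i: "i \<le> j" "fst p = fst (pt w k) + (i - k)" "snd p = snd (pt w k)"
        using p assms(1) by (auto simp: i_def less_eq_prod_def)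
      have "pt w i = (fst (pt w k) + (i - k), snd (pt w k))"
        using run assms(1,2) i(1) ki by (intro pt_run_La) auto
      then show ?thesis using i by (simp add: prod_eq_iff)
    next
      case Lb
      then have run: "l < j \<Longrightarrow> k \<le> l \<Longrightarrow> w ! l = Lb" for l using assms(3)[of l] by simp
      have "pt w j = (fst (pt w k), snd (pt w k) + (j - k))"
        using run assms(1,2) by (intro pt_run_Lb) auto
      then have i: "i \<le> j" "fst p = fst (pt w k)" "snd p = snd (pt w k) + (i - k)"
        using p assms(1) by (auto simp: i_def less_eq_prod_def)
      have "pt w i = (fst (pt w k), snd (pt w k) + (i - k))"
        using run assms(1,2) i(1) ki by (intro pt_run_Lb) auto
      then show ?thesis using i by (simp add: prod_eq_iff)
    qed
    with ki show "p \<in> pt w ` {k..j}" by auto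
  qed
qed

text \<open>
  For nonempty words the assumption is maximality in the class, by \<open>sim2_iff_signature\<close>.
\<close>

locale maximal_word =
  fixes v :: "letter list" and A B :: "(real \<times> real) set"
  assumes A_eq: "A = hull_of La v" and B_eq: "B = hull_of Lb v"
    and maximal: "\<And>u. pt u (length u) = pt v (length v) \<Longrightarrow> hull_of La u = A \<Longrightarrow>
      hull_of Lb u = B \<Longrightarrow> v \<preceq> u \<Longrightarrow> u = v"
begin

lemma convex_A: "convex A" and convex_B: "convex B"
  by (simp_all add: A_eq B_eq)

lemma La_start_in_A: "n < length v \<Longrightarrow> v ! n = La \<Longrightarrow> real_point (pt v n) \<in> A"
  and Lb_start_in_B: "n < length v \<Longrightarrow> v ! n = Lb \<Longrightarrow> real_point (pt v n) \<in> B"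
  by (simp_all add: A_eq B_eq start_in_hull)

lemma vertices_A_subset: "vertices A \<subseteq> starts La v" and vertices_B_subset: "vertices B \<subseteq> starts Lb v"
  by (simp_all add: A_eq B_eq vertices_hull_subset)

text \<open>
  The marked points other than the end point are vertices of a polygon, hence starts of steps.
  They are referred to by their index in the word.
\<close>

definition marked :: "nat \<Rightarrow> bool" where
  "marked n \<longleftrightarrow> pt v n \<in> vertices A \<union> vertices B"

lemma label_marked:
  assumes "n < length v" "marked n"
  shows "label A B (pt v n) = Some (v ! n)"
proof -
  have "v ! n = La" if "pt v n \<in> vertices A"
    using that vertices_A_subset pt_in_starts_iff[OF assms(1)] by blast
  moreover have "v ! n = Lb" if "pt v n \<in> vertices B"
    using that vertices_B_subset pt_in_starts_iff[OF assms(1)] by blast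
  ultimately show ?thesis using assms(2) unfolding label_def marked_def by auto
qed

text \<open>
  After a turn upwards the path turns right again, at a point of \<open>A\<close>, unless it has reached the
  last column. In that case the turn is the lowest point of \<open>B\<close> there, which is a vertex.
\<close>

lemma A_above_up_turn:
  assumes "0 < j" "j < length v" "v ! (j - 1) = La" "v ! j = Lb" "\<not> marked j"
  shows "\<exists>r>0. real_point (fst (pt v j), snd (pt v j) + r) \<in> A"
proof -
  have "\<exists>l. j \<le> l \<and> l < length v \<and> v ! l = La"
  proof (rule ccontr)
    assume "\<not> ?thesis"
    then have "v ! l = Lb" if "j \<le> l" "l < length v" for l using that by (cases "v ! l") auto
    then have "pt v j \<in> vertices B"
      unfolding B_eq by (rule last_column_bottom_extreme[OF assms(1-3)])
    then show False using assms(5) by (simp add: marked_def)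
  qed
  then obtain l0 where l0: "j \<le> l0" "l0 < length v" "v ! l0 = La" by blast
  have "fst (pt v j) < fst (pt v (Suc l0))"
    using pt_fst_mono[OF l0(1), of v] pt_Suc[OF l0(2)] l0(3) by simp
  then obtain l where l: "j \<le> l" "l < Suc l0" "v ! l = La" "\<And>i. j \<le> i \<Longrightarrow> i < l \<Longrightarrow> v ! i = Lb"
    using next_La[of v j "Suc l0"] l0(2) by (metis Suc_leI)
  have "pt v l = (fst (pt v j), snd (pt v j) + (l - j))"
    using l l0 by (intro pt_run_Lb) auto
  moreover have "real_point (pt v l) \<in> A" using l l0 by (intro La_start_in_A) auto
  moreover have "l \<noteq> j" using l(3) assms(4) by auto
  ultimately show ?thesis using l(1) by (intro exI[of _ "l - j"]) auto
qed

text \<open>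
  Let \<open>(x, y)\<close> be the start of the run and \<open>n\<close> its length. Going up first loses the starts
  \<open>(x, y), \<dots>, (x + n - 1, y)\<close> of steps \<open>a\<close> and \<open>(x + n, y)\<close> of a step \<open>b\<close>, none of which is a
  vertex. It gains \<open>(x, y + 1), \<dots>, (x + n - 1, y + 1)\<close> and \<open>(x, y)\<close>. The rightmost new start in
  \<open>A\<close> lies on or below a segment from \<open>(x, y + 1)\<close> to a point of \<open>A\<close> above \<open>(x + n, y)\<close>, and above the
  lost start \<open>(x + n - 1, y)\<close>; so the whole new row is in \<open>A\<close> by convexity.
\<close>

lemma no_local_raise:
  assumes ij: "i < j" "j < length v" and run: "\<And>l. i \<le> l \<Longrightarrow> l < j \<Longrightarrow> v ! l = La" and up: "v ! j = Lb"
    and unmarked: "\<And>l. i \<le> l \<Longrightarrow> l \<le> j \<Longrightarrow> \<not> marked l"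
    and inB: "real_point (pt v i) \<in> B"
    and inA: "real_point (fst (pt v i), Suc (snd (pt v i))) \<in> A"
  shows False
proof -
  define n where "n = j - i"
  define s where "s = take i v"
  define t where "t = drop (Suc j) v"
  obtain x y where xy: "pt v i = (x, y)" by fastforce
  let ?m = "replicate n La @ [Lb]" and ?m' = "Lb # replicate n La"
  define u where "u = s @ ?m' @ t"
  have n: "0 < n" "j = i + n" using ij by (auto simp: n_def)
  have "take n (drop i v) = replicate n La"
    using ij run by (intro nth_equalityI) (auto simp: n_def)
  then have v: "v = s @ ?m @ t"
    using ij up by (simp add: s_def t_def n_def)
      (metis Cons_nth_drop_Suc append_take_drop_id drop_drop le_add_diff_inverse2 less_imp_le)
  have ps: "pt s (length s) = (x, y)"
    using ij xy by (simp add: s_def pt_def)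
  have pm: "pt ?m (length ?m) = pt ?m' (length ?m')"
    unfolding pt_length by (simp add: count_list_replicate)
  \<comment> \<open>The starts outside the stretch, which both words share.\<close>
  define R where "R c = starts c s \<union> (+) (x, y) ` (+) (pt ?m (length ?m)) ` starts c t" for c
  have starts_v: "starts La v = R La \<union> (\<lambda>k. (x + k, y)) ` {..<n}" "starts Lb v = R Lb \<union> {(x + n, y)}"
    unfolding v starts_swap_cong[OF refl] ps starts_La_power_Lb R_def by (auto simp: image_image)
  have starts_u: "starts La u = R La \<union> (\<lambda>k. (x + k, Suc y)) ` {..<n}" "starts Lb u = R Lb \<union> {(x, y)}"
    unfolding u_def starts_swap_cong[OF pm] ps starts_Lb_La_power R_def by (auto simp: image_image)
  have row: "pt v (i + k) = (x + k, y)" if "k \<le> n" for k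
    using pt_run_La[of i "i + k" v] that ij run xy by (simp add: n_def)
  have old_A: "real_point p \<in> A" if "p \<in> starts La v" for p using that by (simp add: A_eq hull_inc)
  have old_B: "real_point p \<in> B" if "p \<in> starts Lb v" for p using that by (simp add: B_eq hull_inc)
  have new_row: "real_point (x + k, Suc y) \<in> A" if k: "k < n" for k
  proof -
    have "v ! (j - 1) = La" "0 < j" "\<not> marked j" using run[of "j - 1"] unmarked[of j] ij by auto
    then obtain r where r: "r > 0" "real_point (x + n, y + r) \<in> A"
      using A_above_up_turn[of j] ij up row[of n] n by auto
    have left: "(real x, real y + 1) \<in> A" using inA xy by (simp add: real_point_def add.commute)
    obtain h where h: "real y + 1 \<le> h" "(real (x + (n - 1)), h) \<in> A"
    proof -
      have "(real (x + n), real (y + r)) \<in> A" using r by (simp add: real_point_def)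
      then show thesis
        using convex_above[OF convex_A left, of _ _ "real (x + (n - 1))" "real y + 1"] r(1) n(1) that
        by fastforce
    qed
    have "(x + (n - 1), y) \<in> starts La v" unfolding starts_v using n(1) by (intro UnI2 image_eqI[of _ _ "n - 1"]) auto
    then have "(real (x + (n - 1)), real y) \<in> A"
      using old_A[of "(x + (n - 1), y)"] by (simp add: real_point_def)
    then have "(real (x + (n - 1)), real y + 1) \<in> A"
      by (rule convex_vertical[OF convex_A _ h(2)]) (use h in auto)
    from convex_horizontal[OF convex_A left this, of "real (x + k)"] show ?thesis
      using k by (simp add: real_point_def add.commute)
  qed
  have "hull_of La u = hull_of La v"
  proof (rule hull_eqI_extreme)
    show "real_point ` starts La u \<subseteq> hull_of La v"
      unfolding A_eq[symmetric]
    proof (intro subsetI, elim imageE)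
      fix z p assume "z = real_point p" "p \<in> starts La u"
      then show "z \<in> A" using old_A[of p] new_row by (auto simp: starts_u starts_v)
    qed
    show "{z. z extreme_point_of hull_of La v} \<subseteq> real_point ` starts La u"
    proof
      fix z assume z: "z \<in> {z. z extreme_point_of hull_of La v}"
      then obtain p where p: "p \<in> starts La v" "z = real_point p"
        by (auto dest: extreme_point_of_convex_hull)
      then have "p \<in> vertices A" using z by (simp add: vertices_def A_eq)
      moreover have "(x + k, y) \<notin> vertices A" if "k < n" for k
        using row[of k] unmarked[of "i + k"] that n by (simp add: marked_def)
      ultimately have "p \<notin> (\<lambda>k. (x + k, y)) ` {..<n}" by blast
      then show "z \<in> real_point ` starts La u" using p by (simp add: starts_u starts_v)
    qed
  qed simp
  moreover have "hull_of Lb u = hull_of Lb v"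
  proof (rule hull_eqI_extreme)
    show "real_point ` starts Lb u \<subseteq> hull_of Lb v"
      unfolding B_eq[symmetric]
    proof (intro subsetI, elim imageE)
      fix z p assume "z = real_point p" "p \<in> starts Lb u"
      then show "z \<in> B" using old_B[of p] inB by (auto simp: starts_u starts_v xy)
    qed
    show "{z. z extreme_point_of hull_of Lb v} \<subseteq> real_point ` starts Lb u"
    proof
      fix z assume z: "z \<in> {z. z extreme_point_of hull_of Lb v}"
      then obtain p where p: "p \<in> starts Lb v" "z = real_point p"
        by (auto dest: extreme_point_of_convex_hull)
      then have "p \<in> vertices B" using z by (simp add: vertices_def B_eq)
      then have "p \<noteq> (x + n, y)"
        using row[of n] unmarked[of j] n by (auto simp: marked_def)
      then show "z \<in> real_point ` starts Lb u" using p by (simp add: starts_u starts_v)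
    qed
  qed simp
  moreover have "pt u (length u) = pt v (length v)"
    using arg_cong[OF v, of "\<lambda>w. pt w (length w)"]
    unfolding pt_length u_def by (simp add: count_list_replicate)
  moreover have "v \<preceq> u"
    using path_le_swap[of s n t] unfolding u_def v[symmetric] .
  ultimately have "u = v" using maximal by (simp add: A_eq B_eq)
  then have "s @ ?m' @ t = s @ ?m @ t" unfolding u_def using v by (rule trans)
  then have "?m' @ t = ?m @ t" by simp
  then show False using n(1) by (cases n) auto
qed

end

section \<open>The construction follows every maximal path\<close>

text \<open>
  The sets \<open>Y\<close> and, in the next definition, \<open>X\<close> of the construction.
\<close>

definition up_turns ::
    "(real \<times> real) set \<Rightarrow> (real \<times> real) set \<Rightarrow> nat \<times> nat \<Rightarrow> nat \<times> nat \<Rightarrow> nat set" where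
  "up_turns A B p q = {k. snd p < k \<and> k \<le> snd q \<and>
     real_point (fst p, k) \<in> A \<and> real_point (fst p, k - 1) \<in> B}"

definition right_turns ::
    "(real \<times> real) set \<Rightarrow> (real \<times> real) set \<Rightarrow> nat \<times> nat \<Rightarrow> nat \<times> nat \<Rightarrow> nat set" where
  "right_turns A B p q = {k. fst p < k \<and> k \<le> fst q \<and>
     real_point (k, snd p) \<in> B \<and> real_point (k - 1, snd p) \<in> A \<and>
     (\<exists>r::nat. r > 0 \<and> real_point (k, snd p + r) \<in> A)}"

lemma gamma_step_eq:
  "gamma_step A B q p l =
     (if snd p = snd q \<or> fst p = fst q then Some (q, label A B q)
      else case l of
        Some Lb \<Rightarrow> if up_turns A B p q = {} then None
                   else Some ((fst p, Max (up_turns A B p q)), Some La)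
      | Some La \<Rightarrow> if right_turns A B p q = {} then None
                   else Some ((Min (right_turns A B p q), snd p), Some Lb)
      | None \<Rightarrow> None)"
  unfolding gamma_step_def up_turns_def right_turns_def Let_def ..

context maximal_word
begin

text \<open>
  If an admissible height lies above the actual turn, then by convexity the turning point is also in
  \<open>B\<close> and the point above it is also in \<open>A\<close>, so the run to the right that follows the turn can be
  raised.
\<close>

lemma up_run_ends_at_Max:
  assumes km: "k < m" "m \<le> length v" and unmarked: "\<And>l. k < l \<Longrightarrow> l < m \<Longrightarrow> \<not> marked l"
    and up: "v ! k = Lb" and x: "fst (pt v k) < fst (pt v m)"
  shows "\<exists>j. k < j \<and> j < m \<and> v ! j = La \<and> (\<forall>l. k \<le> l \<longrightarrow> l < j \<longrightarrow> v ! l = Lb) \<and>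
    up_turns A B (pt v k) (pt v m) \<noteq> {} \<and>
    pt v j = (fst (pt v k), Max (up_turns A B (pt v k) (pt v m)))"
proof -
  define Y where "Y = up_turns A B (pt v k) (pt v m)"
  note Y_def = Y_def[unfolded up_turns_def]
  obtain j where j: "k \<le> j" "j < m" "v ! j = La" and run: "\<And>l. k \<le> l \<Longrightarrow> l < j \<Longrightarrow> v ! l = Lb"
    using next_La[OF x km(2)] by blast
  have kj: "k < j" using j up by (cases "k = j") auto
  define h where "h = snd (pt v j)"
  have ptj: "pt v j = (fst (pt v k), h)" "h = snd (pt v k) + (j - k)"
    using pt_run_Lb[of k j v] j run km by (auto simp: h_def)
  have ptj1: "pt v (j - 1) = (fst (pt v k), h - 1)"
    using pt_run_Lb[of k "j - 1" v] kj j run km ptj(2) by simp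
  have hA: "real_point (fst (pt v k), h) \<in> A"
    using La_start_in_A[of j] j km ptj(1) by simp
  have "real_point (fst (pt v k), h - 1) \<in> B"
    using Lb_start_in_B[of "j - 1"] run[of "j - 1"] kj j km ptj1 by simp
  then have hY: "h \<in> Y"
    using hA kj ptj pt_snd_mono[of j m v] j by (auto simp: Y_def)
  have "h' \<le> h" if h': "h' \<in> Y" for h'
  proof (rule ccontr)
    assume "\<not> h' \<le> h"
    then have lt: "h < h'" by simp
    have "snd (pt v j) < snd (pt v m)" using lt h' by (simp add: Y_def h_def)
    then obtain i where i: "j \<le> i" "i < m" "v ! i = Lb" "\<And>l. j \<le> l \<Longrightarrow> l < i \<Longrightarrow> v ! l = La"
      using next_Lb[of v j m] km(2) by blast
    show False
    proof (rule no_local_raise[of j i])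
      show "j < i" using i j by (cases "i = j") auto
      show "i < length v" using i km by simp
      show "\<not> marked l" if "j \<le> l" "l \<le> i" for l using that kj i unmarked by simp
      have "real_point (pt v k) \<in> B" using Lb_start_in_B[of k] up km by simp
      then have "(real (fst (pt v k)), real (snd (pt v k))) \<in> B" by (simp add: real_point_def)
      moreover have "(real (fst (pt v k)), real (h' - 1)) \<in> B"
        using h' unfolding Y_def real_point_def mem_Collect_eq fst_conv snd_conv by blast
      ultimately have "(real (fst (pt v k)), real h) \<in> B"
        by (rule convex_vertical[OF convex_B]) (use lt ptj(2) in auto)
      then show "real_point (pt v j) \<in> B" by (simp add: ptj(1) real_point_def)
      have "(real (fst (pt v k)), real h) \<in> A" "(real (fst (pt v k)), real h') \<in> A"
        using hA h' by (simp_all add: Y_def real_point_def)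
      then have "(real (fst (pt v k)), real (Suc h)) \<in> A"
        by (rule convex_vertical[OF convex_A]) (use lt in auto)
      then show "real_point (fst (pt v j), Suc (snd (pt v j))) \<in> A"
        by (simp add: ptj(1) real_point_def)
    qed (use i in auto)
  qed
  moreover have "finite Y" by (rule finite_subset[of _ "{..snd (pt v m)}"]) (auto simp: Y_def)
  ultimately have "Max Y = h" using hY by (intro Max_eqI) auto
  moreover have "Y = up_turns A B (pt v k) (pt v m)" by (simp add: Y_def up_turns_def)
  ultimately show ?thesis using kj j run hY ptj(1) by (intro exI[of _ j]) auto
qed

text \<open>
  An admissible column \<open>c'\<close> before the actual turn gives a point of \<open>B\<close> on the run. This point
  is in \<open>A\<close> too, and the third condition in \<open>X\<close> puts a higher point of the column into \<open>A\<close>, so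
  the point directly above is in \<open>A\<close> and the remaining part of the run can be raised.
\<close>

lemma right_run_ends_at_Min:
  assumes km: "k < m" "m \<le> length v" and unmarked: "\<And>l. k < l \<Longrightarrow> l < m \<Longrightarrow> \<not> marked l"
    and right: "v ! k = La" and y: "snd (pt v k) < snd (pt v m)"
  shows "\<exists>j. k < j \<and> j < m \<and> v ! j = Lb \<and> (\<forall>l. k \<le> l \<longrightarrow> l < j \<longrightarrow> v ! l = La) \<and>
    right_turns A B (pt v k) (pt v m) \<noteq> {} \<and>
    pt v j = (Min (right_turns A B (pt v k) (pt v m)), snd (pt v k))"
proof -
  define X where "X = right_turns A B (pt v k) (pt v m)"
  note X_def = X_def[unfolded right_turns_def]
  obtain j where j: "k \<le> j" "j < m" "v ! j = Lb" and run: "\<And>l. k \<le> l \<Longrightarrow> l < j \<Longrightarrow> v ! l = La"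
    using next_Lb[OF y km(2)] by blast
  have kj: "k < j" using j right by (cases "k = j") auto
  define c where "c = fst (pt v j)"
  have row: "pt v i = (fst (pt v k) + (i - k), snd (pt v k))" if "k \<le> i" "i \<le> j" for i
    using pt_run_La[of k i v] that j run km by simp
  have ptj: "pt v j = (c, snd (pt v k))" "c = fst (pt v k) + (j - k)"
    using row[of j] j by (auto simp: c_def)
  have ptj1: "pt v (j - 1) = (c - 1, snd (pt v k))"
    using row[of "j - 1"] kj ptj(2) by simp
  have "real_point (c, snd (pt v k)) \<in> B"
    using Lb_start_in_B[of j] j km ptj(1) by simp
  moreover have "real_point (c - 1, snd (pt v k)) \<in> A"
    using La_start_in_A[of "j - 1"] run[of "j - 1"] kj j km ptj1 by simp
  moreover have "\<exists>r>0. real_point (c, snd (pt v k) + r) \<in> A"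
    using A_above_up_turn[of j] kj j km run[of "j - 1"] unmarked[of j] ptj(1) by simp
  ultimately have cX: "c \<in> X"
    using kj ptj pt_fst_mono[of j m v] j by (auto simp: X_def)
  have "c \<le> c'" if c': "c' \<in> X" for c'
  proof (rule ccontr)
    assume "\<not> c \<le> c'"
    then have lt: "c' < c" by simp
    define i where "i = k + (c' - fst (pt v k))"
    have i: "k < i" "i < j" "pt v i = (c', snd (pt v k))"
      using c' lt ptj(2) row[of i] by (auto simp: X_def i_def)
    show False
    proof (rule no_local_raise[of i j])
      show "\<not> marked l" if "i \<le> l" "l \<le> j" for l using that i j unmarked by simp
      show "real_point (pt v i) \<in> B" using c' i by (simp add: X_def)
      obtain r where r: "r > 0" "real_point (c', snd (pt v k) + r) \<in> A" using c' by (auto simp: X_def)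
      have "real_point (pt v i) \<in> A" using La_start_in_A[of i] i j run km by simp
      then have "(real c', real (snd (pt v k))) \<in> A" "(real c', real (snd (pt v k) + r)) \<in> A"
        using i(3) r(2) by (simp_all add: real_point_def)
      then have "(real c', real (Suc (snd (pt v k)))) \<in> A"
        by (rule convex_vertical[OF convex_A]) (use r(1) in auto)
      then show "real_point (fst (pt v i), Suc (snd (pt v i))) \<in> A"
        using i by (simp add: real_point_def)
    qed (use i j run km in auto)
  qed
  moreover have "finite X" by (rule finite_subset[of _ "{..fst (pt v m)}"]) (auto simp: X_def)
  ultimately have "Min X = c" using cX by (intro Min_eqI) auto
  moreover have "X = right_turns A B (pt v k) (pt v m)" by (simp add: X_def right_turns_def)
  ultimately show ?thesis using kj j run cX ptj(1) by (intro exI[of _ j]) auto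
qed

lemma gamma_step_follows_path:
  assumes km: "k < m" "m \<le> length v" and unmarked: "\<And>l. k < l \<Longrightarrow> l < m \<Longrightarrow> \<not> marked l"
  shows "\<exists>j l'. k < j \<and> j \<le> m \<and> (\<forall>l. k \<le> l \<longrightarrow> l < j \<longrightarrow> v ! l = v ! k) \<and>
    gamma_step A B (pt v m) (pt v k) (Some (v ! k)) = Some (pt v j, l') \<and>
    (j < m \<longrightarrow> l' = Some (v ! j))"
proof (cases "snd (pt v k) = snd (pt v m) \<or> fst (pt v k) = fst (pt v m)")
  case True
  \<comment> \<open>A monotone path between two points of a horizontal or vertical line does not leave it.\<close>
  have "v ! l = v ! k" if l: "k \<le> l" "l < m" for l
  proof -
    have mono: "fst (pt v k) \<le> fst (pt v i)" "snd (pt v k) \<le> snd (pt v i)"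
      "fst (pt v (Suc i)) \<le> fst (pt v m)" "snd (pt v (Suc i)) \<le> snd (pt v m)" if "k \<le> i" "i < m" for i
      using that pt_fst_mono[of k i v] pt_snd_mono[of k i v] pt_fst_mono[of "Suc i" m v]
        pt_snd_mono[of "Suc i" m v] by auto
    have "v ! i = (if snd (pt v k) = snd (pt v m) then La else Lb)" if "k \<le> i" "i < m" for i
      using True mono[OF that] pt_Suc[of i v] that km by (cases "v ! i") (auto split: if_splits)
    then show ?thesis using l km by simp
  qed
  moreover have "gamma_step A B (pt v m) (pt v k) (Some (v ! k)) = Some (pt v m, label A B (pt v m))"
    using True by (simp add: gamma_step_eq)
  ultimately show ?thesis using km by blast
next
  case False
  then have lt: "fst (pt v k) < fst (pt v m)" "snd (pt v k) < snd (pt v m)"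
    using pt_fst_mono[of k m v] pt_snd_mono[of k m v] km by auto
  show ?thesis
  proof (cases "v ! k")
    case Lb
    obtain j where j: "k < j" "j < m" "v ! j = La" "\<forall>l. k \<le> l \<longrightarrow> l < j \<longrightarrow> v ! l = Lb"
      "up_turns A B (pt v k) (pt v m) \<noteq> {}"
      "pt v j = (fst (pt v k), Max (up_turns A B (pt v k) (pt v m)))"
      using up_run_ends_at_Max[OF km unmarked Lb lt(1)] by blast
    have "gamma_step A B (pt v m) (pt v k) (Some (v ! k)) = Some (pt v j, Some La)"
      using False j(5) by (simp add: gamma_step_eq Lb j(6))
    then show ?thesis using j(1-4) Lb by (intro exI[of _ j] exI[of _ "Some La"]) simp
  next
    case La
    obtain j where j: "k < j" "j < m" "v ! j = Lb" "\<forall>l. k \<le> l \<longrightarrow> l < j \<longrightarrow> v ! l = La"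
      "right_turns A B (pt v k) (pt v m) \<noteq> {}"
      "pt v j = (Min (right_turns A B (pt v k) (pt v m)), snd (pt v k))"
      using right_run_ends_at_Min[OF km unmarked La lt(2)] by blast
    have "gamma_step A B (pt v m) (pt v k) (Some (v ! k)) = Some (pt v j, Some Lb)"
      using False j(5) by (simp add: gamma_step_eq La j(6))
    then show ?thesis using j(1-4) La by (intro exI[of _ j] exI[of _ "Some Lb"]) simp
  qed
qed

text \<open>
  Each pass of the loop advances along a straight stretch of the path, and the box between the ends
  of a straight stretch contains exactly its points.
\<close>

lemma gamma_loop_follows_path:
  assumes "k \<le> m" "m \<le> length v" "\<And>l. k < l \<Longrightarrow> l < m \<Longrightarrow> \<not> marked l"
    and "k < m \<Longrightarrow> lab = Some (v ! k)" and "pt v k \<in> S"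
  shows "gamma_loop A B (pt v m) (pt v k) lab S = Some (S \<union> pt v ` {k..m})"
  using assms
proof (induction "m - k" arbitrary: k lab S rule: less_induct)
  case less
  show ?case
  proof (cases "k = m")
    case True
    then show ?thesis using less.prems(5) by (simp add: gamma_loop.simps insert_absorb)
  next
    case False
    then have km: "k < m" using less.prems(1) by simp
    obtain j l' where j: "k < j" "j \<le> m" "\<forall>l. k \<le> l \<longrightarrow> l < j \<longrightarrow> v ! l = v ! k"
      "gamma_step A B (pt v m) (pt v k) (Some (v ! k)) = Some (pt v j, l')"
      "j < m \<longrightarrow> l' = Some (v ! j)"
      using gamma_step_follows_path[OF km less.prems(2,3)] by blast
    have box: "{pt v k..pt v j} = pt v ` {k..j}"
      by (rule straight_box) (use j(1,2) less.prems(2) in simp, use less.prems(2) j(2) in simp, use j(3) in blast)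
    have "pt v k \<noteq> pt v m" using pt_inj[of k v m] km less.prems(2) by auto
    then have "gamma_loop A B (pt v m) (pt v k) lab S =
        gamma_loop A B (pt v m) (pt v j) l' (S \<union> pt v ` {k..j})"
      using j(4) less.prems(4)[OF km] box by (subst gamma_loop.simps) simp
    also have "\<dots> = Some (S \<union> pt v ` {k..j} \<union> pt v ` {j..m})"
      using j(1,2,5) less.prems(2,3) km by (intro less.hyps) auto
    also have "S \<union> pt v ` {k..j} \<union> pt v ` {j..m} = S \<union> pt v ` {k..m}"
      using ivl_disj_un_two_touch(4)[of k j m] j(1,2) by (simp add: Un_assoc flip: image_Un)
    finally show ?thesis .
  qed
qed

end

lemma sorted_list_intervals_cover:
  fixes xs :: "nat list"
  assumes "sorted xs" "length xs \<ge> 2"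
  shows "(\<Union>i<length xs - 1. {xs ! i..xs ! Suc i}) = {hd xs..last xs}"
  using assms
proof (induction xs rule: induct_list012)
  case (3 x y zs)
  show ?case
  proof (cases zs)
    case Nil
    then show ?thesis by (simp add: lessThan_Suc)
  next
    case (Cons z zs')
    then have IH: "(\<Union>i<length zs. {(y # zs) ! i..(y # zs) ! Suc i}) = {y..last zs}"
      using 3 by simp
    have "{..<Suc (length zs)} = insert 0 (Suc ` {..<length zs})" by (rule lessThan_Suc_eq_insert_0)
    then have "(\<Union>i<length (x # y # zs) - 1. {(x # y # zs) ! i..(x # y # zs) ! Suc i}) =
        {x..y} \<union> {y..last zs}"
      unfolding IH[symmetric] by simp
    also have "\<dots> = {x..last zs}"
      using 3(3) Cons by (intro ivl_disj_un_two_touch(4)) auto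
    finally show ?thesis using Cons by simp
  qed
qed auto

lemma those_map_Some: "those (map (\<lambda>i. Some (g i)) xs) = Some (map g xs)"
  by (induction xs) auto

text \<open>
  The coordinatewise order is not total, but the sum of the coordinates is strictly monotone and
  hence injective on a chain, which reduces the claim to lists of natural numbers.
\<close>

lemma sorted_wrt_less_unique:
  fixes ps qs :: "(nat \<times> nat) list"
  assumes "sorted_wrt (<) ps" "sorted_wrt (<) qs" "set ps = set qs"
  shows "ps = qs"
proof -
  let ?f = "\<lambda>p :: nat \<times> nat. fst p + snd p"
  have mono: "?f p < ?f q" if "p < q" for p q
    using that by (auto simp: less_prod_def less_eq_prod_def)
  have sorted: "sorted_wrt (<) (map ?f rs)" if "sorted_wrt (<) rs" for rs
    unfolding sorted_wrt_map by (rule sorted_wrt_mono_rel[OF _ that]) (rule mono)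
  have "map ?f ps = map ?f qs"
    using sorted[OF assms(1)] sorted[OF assms(2)] assms(3)
    by (intro strict_sorted_equal) auto
  moreover have "inj_on ?f (set ps \<union> set qs)"
  proof (rule inj_onI)
    fix p q assume "p \<in> set ps \<union> set qs" "q \<in> set ps \<union> set qs" and eq: "?f p = ?f q"
    then have "p \<in> set ps" "q \<in> set ps" using assms(3) by simp_all
    then obtain i j where "i < length ps" "j < length ps" "p = ps ! i" "q = ps ! j"
      by (metis in_set_conv_nth)
    then show "p = q"
      using mono[OF sorted_wrt_nth_less[OF assms(1), of i j]]
        mono[OF sorted_wrt_nth_less[OF assms(1), of j i]] eq
      by (cases i j rule: linorder_cases) auto
  qed
  ultimately show ?thesis by (rule map_inj_on)
qed

context maximal_word
begin

definition marks :: "nat list" where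
  "marks = sorted_list_of_set {n. n \<le> length v \<and> (n = length v \<or> marked n)}"

lemma set_marks: "set marks = {n. n \<le> length v \<and> (n = length v \<or> marked n)}"
  by (simp add: marks_def)

lemma sorted_marks: "sorted_wrt (<) marks"
  by (simp add: marks_def)

lemma marked_points_eq:
  "marked_points (count_list v La) (count_list v Lb) A B = map (pt v) marks"
  unfolding marked_points_def
proof (rule the_equality, intro conjI)
  have "sorted_wrt (\<lambda>i j. pt v i < pt v j) marks"
    by (rule sorted_wrt_mono_rel[OF _ sorted_marks]) (auto simp: set_marks pt_less_iff)
  then show sorted: "sorted_wrt (<) (map (pt v) marks)" by (simp add: sorted_wrt_map)
  have "vertices A \<union> vertices B \<subseteq> pt v ` {..<length v}"
    using vertices_A_subset vertices_B_subset by (auto simp: starts_def)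
  then have 1: "vertices A \<union> vertices B = pt v ` {n. n < length v \<and> marked n}"
    unfolding marked_def by blast
  have 2: "set marks = insert (length v) {n. n < length v \<and> marked n}"
    by (auto simp: set_marks)
  show set: "set (map (pt v) marks) =
      vertices A \<union> vertices B \<union> {(count_list v La, count_list v Lb)}"
    unfolding 1 2 set_map image_insert pt_length by simp
  fix ps
  assume "sorted_wrt (<) ps \<and>
      set ps = vertices A \<union> vertices B \<union> {(count_list v La, count_list v Lb)}"
  then show "ps = map (pt v) marks"
    using sorted set by (intro sorted_wrt_less_unique) auto
qed

text \<open>
  The marked indices include \<open>0\<close> and the length of the word, so the stretches between consecutive
  ones make up the whole path.
\<close>

lemma gamma_bar_eq_path:
  assumes "v \<noteq> []"
  shows "gamma_bar (count_list v La) (count_list v Lb) A B = Some (word_path v)"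
proof -
  let ?n = "length marks - 1"
  have "pt v 0 \<in> vertices A \<union> vertices B"
    using first_point_extreme[of v] assms by (cases "v ! 0") (simp_all add: A_eq B_eq)
  then have "0 \<in> set marks" by (simp add: set_marks marked_def)
  have "length v \<in> set marks" by (simp add: set_marks)
  have sorted: "sorted marks" "distinct marks" using sorted_marks by (simp_all add: strict_sorted_iff)
  have ne: "marks \<noteq> []" using \<open>0 \<in> set marks\<close> by auto
  have hd: "hd marks = 0"
    using \<open>0 \<in> set marks\<close> sorted(1) by (cases marks) auto
  have last: "last marks = length v"
  proof -
    have "last marks \<le> length v" using last_in_set[OF ne] by (simp add: set_marks)
    moreover obtain i where "i < length marks" "marks ! i = length v"
      using \<open>length v \<in> set marks\<close> by (auto simp: in_set_conv_nth)
    moreover from this have "marks ! i \<le> last marks"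
      using sorted_nth_mono[OF sorted(1), of i "length marks - 1"] by (simp add: last_conv_nth[OF ne])
    ultimately show ?thesis by simp
  qed
  have "card {0, length v} \<le> card (set marks)"
    using \<open>0 \<in> set marks\<close> \<open>length v \<in> set marks\<close> by (intro card_mono) auto
  then have len: "length marks \<ge> 2"
    using assms card_length[of marks] by simp
  have segment: "gamma_segment A B (pt v (marks ! i)) (pt v (marks ! Suc i)) =
      Some (pt v ` {marks ! i..marks ! Suc i})" if i: "i < ?n" for i
  proof -
    have lt: "marks ! i < marks ! Suc i" using i sorted_wrt_nth_less[OF sorted_marks] by simp
    have mem: "marks ! i \<in> set marks" "marks ! Suc i \<in> set marks" using i by simp_all
    have le: "marks ! Suc i \<le> length v" using mem by (simp add: set_marks)
    have "\<not> marked l" if l: "marks ! i < l" "l < marks ! Suc i" for l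
    proof
      assume "marked l"
      then have "l \<in> set marks" using l le by (simp add: set_marks)
      then obtain h where h: "h < length marks" "marks ! h = l" by (auto simp: in_set_conv_nth)
      have "i < h" using l h sorted_nth_mono[OF sorted(1), of h i] i by (force simp: not_less)
      moreover have "h < Suc i"
        using l h sorted_nth_mono[OF sorted(1), of "Suc i" h] by (force simp: not_less)
      ultimately show False by simp
    qed
    moreover have "label A B (pt v (marks ! i)) = Some (v ! (marks ! i))"
      using mem lt le by (intro label_marked) (auto simp: set_marks)
    ultimately show ?thesis
      unfolding gamma_segment_def using lt le by (subst gamma_loop_follows_path) auto
  qed
  have segments: "map (\<lambda>i. gamma_segment A B (map (pt v) marks ! i) (map (pt v) marks ! Suc i)) [0..<?n] =
      map (\<lambda>i. Some (pt v ` {marks ! i..marks ! Suc i})) [0..<?n]"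
    using segment by (intro map_cong) auto
  have "gamma_bar (count_list v La) (count_list v Lb) A B =
      Some (\<Union>i<?n. pt v ` {marks ! i..marks ! Suc i})"
    unfolding gamma_bar_def marked_points_eq Let_def length_map segments
    by (simp add: those_map_Some atLeast0LessThan)
  also have "(\<Union>i<?n. pt v ` {marks ! i..marks ! Suc i}) = word_path v"
    using sorted_list_intervals_cover[OF sorted(1) len] hd last
    by (simp add: word_path_eq atLeast0AtMost flip: image_UN)
  finally show ?thesis .
qed

end

theorem theorem4p9:
  fixes la lb :: nat and w :: "letter list" and A B :: "(real \<times> real) set"
  assumes "w \<in> words la lb"
    and "w \<noteq> []"
    and "signature w = (A, B)"
  shows "\<exists>v. (\<forall>u. maximal_in_class w u \<longleftrightarrow> u = v) \<and>
             gamma_bar la lb A B = Some (word_path v)"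
proof -
  \<comment> \<open>The left-hand side does not mention \<open>v\<close>, which gives uniqueness.\<close>
  have path: "gamma_bar la lb A B = Some (word_path v)" if v: "maximal_in_class w v" for v
  proof -
    have cls: "pt v (length v) = pt w (length w)" "signature v = signature w" "v \<noteq> []"
      using v mem_sim2_class_iff[OF assms(2)] by (auto simp: maximal_in_class_def sim2_class_def)
    interpret maximal_word v A B
    proof
      show "A = hull_of La v" "B = hull_of Lb v" using assms(3) cls by (simp_all add: signature_eq)
      fix u assume "pt u (length u) = pt v (length v)" "hull_of La u = A" "hull_of Lb u = B" "v \<preceq> u"
      then show "u = v"
        using v assms(3) cls mem_sim2_class_iff[OF assms(2), of u]
        by (simp add: maximal_in_class_def signature_eq)
    qed
    show ?thesis
      using gamma_bar_eq_path[OF cls(3)] cls(1) assms(1) by (simp add: words_def pt_length)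
  qed
  obtain v where v: "maximal_in_class w v" using maximal_in_class_exists[OF assms(2)] by blast
  have "u = v" if "maximal_in_class w u" for u
    using path[OF that] path[OF v] by (auto intro: word_path_inject)
  then show ?thesis using v path by blast
qed

end
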